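(* Suppose $(G,p,q)$ is a generic globally rigid linearly constrained framework in $\mathbb{R}^d$. Then each connected component of $G$ is either a single vertex with at least $d$ loops, or is $d$-balanced and redundantly rigid in $\mathbb{R}^d$.
   Context: A looped simple graph $G=(V,E,L)$: $E$ is a set of non-loop edges with no parallel edges, $L$ a set of loops (several may be at one vertex). A $d$-dimensional linearly constrained framework is $(G,p,q)$ with $p:V\to\mathbb{R}^d$, $q:L\to\mathbb{R}^d$; generic means all coordinates of $p,q$ are algebraically independent over $\mathbb{Q}$. $(G,p',q)$ is equivalent to $(G,p,q)$ if $\|p(u)-p(v)\|=\|p'(u)-p'(v)\|$ for all $uv\in E$ and $p(v)\cdot q(\ell)=p'(v)\cdot q(\ell)$ for each loop $\ell$ at $v$; globally rigid means the only equivalent framework is itself. The rigidity matrix $R(G,p,q)$ is the $(|E|+|L|)\times d|V|$ matrix whose row for $uv\in E$ has $p(u)-p(v)$ in the columns of $u$ and $p(v)-p(u)$ in the columns of $v$, and whose row for a loop $\ell$ at $v$ has $q(\ell)$ in the columns of $v$ (zeros elsewhere). A looped simple graph $H$ is rigid in $\mathbb{R}^d$ if $\operatorname{rank}R(H,p,q)=d|V(H)|$ for some realisation, and redundantly rigid in $\mathbb{R}^d$ if $H-e$ is rigid in $\mathbb{R}^d$ for every edge or loop $e$. $H$ is $d$-balanced if for every set $X$ of $d$ vertices, each connected component of $H-X$ contains at least one loop. *)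

theory Defs
  imports "HOL-Analysis.Analysis" "HOL-Library.Poly_Mapping"
begin

section \<open>Looped simple graphs\<close>

text \<open>
  Non-loop edges are two-element sets of vertices, so there are no parallel ones. Loops have their
  own type and an incidence map \<open>anchor\<close>, so several loops may sit at one vertex. Graphs live on
  subsets of finite types of vertices and loops, hence are finite.
\<close>

record ('v, 'l) lgraph =
  verts :: "'v set"
  edges :: "'v set set"
  loops :: "'l set"
  anchor :: "'l \<Rightarrow> 'v"

definition looped_simple_graph :: "('v, 'l) lgraph \<Rightarrow> bool" where
  "looped_simple_graph G \<longleftrightarrow>
     (\<forall>e \<in> edges G. e \<subseteq> verts G \<and> card e = 2) \<and> (\<forall>l \<in> loops G. anchor G l \<in> verts G)"

definition induced_subgraph :: "('v, 'l) lgraph \<Rightarrow> 'v set \<Rightarrow> ('v, 'l) lgraph" where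
  "induced_subgraph G W =
     G\<lparr>verts := verts G \<inter> W, edges := {e \<in> edges G. e \<subseteq> W},
       loops := {l \<in> loops G. anchor G l \<in> W}\<rparr>"

definition delete_verts :: "('v, 'l) lgraph \<Rightarrow> 'v set \<Rightarrow> ('v, 'l) lgraph" where
  "delete_verts G X = induced_subgraph G (verts G - X)"

definition delete_edge :: "('v, 'l) lgraph \<Rightarrow> 'v set \<Rightarrow> ('v, 'l) lgraph" where
  "delete_edge G e = G\<lparr>edges := edges G - {e}\<rparr>"

definition delete_loop :: "('v, 'l) lgraph \<Rightarrow> 'l \<Rightarrow> ('v, 'l) lgraph" where
  "delete_loop G l = G\<lparr>loops := loops G - {l}\<rparr>"

definition connectivity :: "('v, 'l) lgraph \<Rightarrow> 'v rel" where
  "connectivity G = {(u, v). {u, v} \<in> edges G}\<^sup>* \<inter> verts G \<times> verts G"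

definition graph_components :: "('v, 'l) lgraph \<Rightarrow> ('v, 'l) lgraph set" where
  "graph_components G = induced_subgraph G ` (verts G // connectivity G)"

definition balanced :: "nat \<Rightarrow> ('v, 'l) lgraph \<Rightarrow> bool" where
  "balanced d G \<longleftrightarrow>
     (\<forall>X \<subseteq> verts G. card X = d \<longrightarrow> (\<forall>C \<in> graph_components (delete_verts G X). loops C \<noteq> {}))"


section \<open>Linearly constrained frameworks\<close>

text \<open>
  A framework is a triple \<open>G\<close>, \<open>p\<close>, \<open>q\<close>; only the values of \<open>p\<close> on \<open>verts G\<close> and of \<open>q\<close> on
  \<open>loops G\<close> matter.
\<close>

definition equivalent_frameworks ::
    "('v, 'l) lgraph \<Rightarrow> ('l \<Rightarrow> real^'d) \<Rightarrow> ('v \<Rightarrow> real^'d) \<Rightarrow> ('v \<Rightarrow> real^'d) \<Rightarrow> bool" where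
  "equivalent_frameworks G q p p' \<longleftrightarrow>
     (\<forall>u v. {u, v} \<in> edges G \<longrightarrow> norm (p u - p v) = norm (p' u - p' v)) \<and>
     (\<forall>l \<in> loops G. p (anchor G l) \<bullet> q l = p' (anchor G l) \<bullet> q l)"

definition globally_rigid ::
    "('v, 'l) lgraph \<Rightarrow> ('v \<Rightarrow> real^'d) \<Rightarrow> ('l \<Rightarrow> real^'d) \<Rightarrow> bool" where
  "globally_rigid G p q \<longleftrightarrow>
     (\<forall>p'. equivalent_frameworks G q p p' \<longrightarrow> (\<forall>v \<in> verts G. p' v = p v))"

text \<open>
  Polynomials over the rationals in variables of type \<open>'i\<close> are finitely supported maps from
  monomials (finitely supported exponent vectors) to coefficients.
\<close>

type_synonym 'i rat_mpoly = "('i \<Rightarrow>\<^sub>0 nat) \<Rightarrow>\<^sub>0 rat"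

definition mpoly_vars :: "'i rat_mpoly \<Rightarrow> 'i set" where
  "mpoly_vars P = (\<Union>m \<in> Poly_Mapping.keys P. Poly_Mapping.keys m)"

definition mpoly_eval :: "('i \<Rightarrow> real) \<Rightarrow> 'i rat_mpoly \<Rightarrow> real" where
  "mpoly_eval x P =
     (\<Sum>m \<in> Poly_Mapping.keys P.
        of_rat (Poly_Mapping.lookup P m) *
        (\<Prod>i \<in> Poly_Mapping.keys m. x i ^ Poly_Mapping.lookup m i))"

definition alg_independent :: "'i set \<Rightarrow> ('i \<Rightarrow> real) \<Rightarrow> bool" where
  "alg_independent I x \<longleftrightarrow> (\<forall>P. mpoly_vars P \<subseteq> I \<longrightarrow> mpoly_eval x P = 0 \<longrightarrow> P = 0)"

definition generic_framework ::
    "('v, 'l) lgraph \<Rightarrow> ('v \<Rightarrow> real^'d) \<Rightarrow> ('l \<Rightarrow> real^'d) \<Rightarrow> bool" where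
  "generic_framework G p q \<longleftrightarrow>
     alg_independent ((verts G \<times> UNIV) <+> (loops G \<times> UNIV))
       (case_sum (\<lambda>(v, i). p v $ i) (\<lambda>(l, i). q l $ i))"


section \<open>Rigidity\<close>

text \<open>
  Rows are indexed by all potential edges and loops and columns by all potential vertices, each
  with \<open>d\<close> coordinates. The rows outside \<open>edges G\<close> and \<open>loops G\<close> and, for a looped simple graph,
  the columns outside \<open>verts G\<close> are zero, so the rank is that of the
  \<open>(|E| + |L|) \<times> d|V|\<close> matrix. For an edge \<open>e\<close> and \<open>w \<in> e\<close>, \<open>the_elem (e - {w})\<close> is the
  other end of \<open>e\<close>.
\<close>

definition rigidity_matrix ::
    "('v::finite, 'l::finite) lgraph \<Rightarrow> ('v \<Rightarrow> real^'d) \<Rightarrow> ('l \<Rightarrow> real^'d) \<Rightarrow>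
      real^('v \<times> 'd)^('v set + 'l)" where
  "rigidity_matrix G p q = (\<chi> r c. case c of (w, i) \<Rightarrow>
     (case r of
        Inl e \<Rightarrow> if e \<in> edges G \<and> w \<in> e then (p w - p (the_elem (e - {w}))) $ i else 0
      | Inr l \<Rightarrow> if l \<in> loops G \<and> w = anchor G l then q l $ i else 0))"

lemma rigidity_matrix_edge:
  assumes "{u, v} \<in> edges G" "u \<noteq> v"
  shows "rigidity_matrix G p q $ Inl {u, v} $ (w, i) =
    (if w = u then (p u - p v) $ i else if w = v then (p v - p u) $ i else 0)"
proof -
  have "{u, v} - {u} = {v}" "{u, v} - {v} = {u}"
    using assms(2) by auto
  then show ?thesis
    using assms by (auto simp: rigidity_matrix_def)
qed

definition rigid :: "'d::finite itself \<Rightarrow> ('v::finite, 'l::finite) lgraph \<Rightarrow> bool" where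
  "rigid _ G \<longleftrightarrow>
     (\<exists>(p :: 'v \<Rightarrow> real^'d) (q :: 'l \<Rightarrow> real^'d).
        rank (rigidity_matrix G p q) = CARD('d) * card (verts G))"

definition redundantly_rigid :: "'d::finite itself \<Rightarrow> ('v::finite, 'l::finite) lgraph \<Rightarrow> bool" where
  "redundantly_rigid D G \<longleftrightarrow>
     (\<forall>e \<in> edges G. rigid D (delete_edge G e)) \<and> (\<forall>l \<in> loops G. rigid D (delete_loop G l))"

end

theory Submission
  imports Defs "HOL-Computational_Algebra.Polynomial"
begin

text \<open>
  The necessary conditions other than redundant rigidity come from explicit second realisations:
  reflect a loopless component of \<open>H - X\<close> in the hyperplane spanned by \<open>p ` X\<close>, translate a part
  with too few loops across a bridge, or send \<open>p\<close> to \<open>t - p\<close> if there are at most \<open>d\<close> loops.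

  Redundant rigidity follows Hendrickson's argument. If removing one constraint \<open>g\<close> destroys
  rigidity, the realisations satisfying all other constraints form a compact one-dimensional
  manifold through \<open>p\<close>, along which \<open>g\<close> has non-zero derivative at \<open>p\<close>, so \<open>g\<close> takes its value at
  \<open>p\<close> a second time. Two shortcuts keep this elementary. That the fibre through a generic point
  is regular everywhere is seen by applying derivations of the reals to the constraint equations;
  derivations with prescribed values on algebraically independent reals exist by Zorn's lemma.
  The classification of curves is replaced by a null-homotopy: if \<open>p\<close> were the only point, the
  constraint map, modified away from the fibre, would have a single nondegenerate zero in a ball
  and yet be null-homotopic on its boundary, contradicting the non-contractibility of the sphere.
\<close>

section \<open>Derivations of the reals\<close>

text \<open>Points of the fibre other than \<open>p\<close> need not be generic, so genericity says
  nothing about them directly. Derivations close this gap: if \<open>x\<close> and \<open>p\<close>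
  satisfy the same equations, a derivation that moves \<open>p\<close> with a given velocity moves
  \<open>x\<close> with a velocity that changes each constraint by the same amount. Constraints
  independent at \<open>p\<close> are therefore independent at \<open>x\<close>, however degenerate
  \<open>x\<close> may be.

  The remaining constraints may outnumber the unknowns, whereas the homotopy argument needs equally
  many of both. Only a maximal independent subset \<open>S\<close> of them is kept next to
  \<open>g\<close>. Its equations can have additional solutions away from the fibre; constant rank
  shows that these form a closed set, and there \<open>g\<close> is replaced by the constant 1.

  Compactness of the fibre is not automatic either. It holds once every component left after the
  deletion has at least \<open>d\<close> loops, because their generic directions span the space.
  This is why lower bounds for numbers of loops come before redundant rigidity.\<close>

definition derivation :: "(real \<Rightarrow> real) \<Rightarrow> bool" where
  "derivation D \<longleftrightarrow> (\<forall>a b. D (a + b) = D a + D b) \<and> (\<forall>a b. D (a * b) = a * D b + D a * b)"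

text \<open>
  The graph of a derivation on a subring of the reals, seen as a subring of the dual numbers
  \<open>a + \<epsilon> a'\<close>; the last condition makes it the graph of a function.
\<close>

definition dual_subring :: "(real \<times> real) set \<Rightarrow> bool" where
  "dual_subring \<Gamma> \<longleftrightarrow> (1, 0) \<in> \<Gamma> \<and>
     (\<forall>a a' b b'. (a, a') \<in> \<Gamma> \<longrightarrow> (b, b') \<in> \<Gamma> \<longrightarrow>
        (a - b, a' - b') \<in> \<Gamma> \<and> (a * b, a * b' + a' * b) \<in> \<Gamma>) \<and>
     (\<forall>b. (0, b) \<in> \<Gamma> \<longrightarrow> b = 0)"

context
  fixes \<Gamma> :: "(real \<times> real) set"
  assumes ring: "dual_subring \<Gamma>"
begin

lemma dual_one: "(1, 0) \<in> \<Gamma>"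
  and dual_diff: "(a, a') \<in> \<Gamma> \<Longrightarrow> (b, b') \<in> \<Gamma> \<Longrightarrow> (a - b, a' - b') \<in> \<Gamma>"
  and dual_mult: "(a, a') \<in> \<Gamma> \<Longrightarrow> (b, b') \<in> \<Gamma> \<Longrightarrow> (a * b, a * b' + a' * b) \<in> \<Gamma>"
  and dual_functional: "(0, b) \<in> \<Gamma> \<Longrightarrow> b = 0"
  using ring by (auto simp: dual_subring_def)

lemma dual_zero: "(0, 0) \<in> \<Gamma>"
  using dual_diff[OF dual_one dual_one] by simp

lemma dual_add: "(a, a') \<in> \<Gamma> \<Longrightarrow> (b, b') \<in> \<Gamma> \<Longrightarrow> (a + b, a' + b') \<in> \<Gamma>"
  using dual_diff[OF _ dual_diff[OF dual_zero]] by force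

lemma dual_sum:
  assumes "\<And>i. i \<in> A \<Longrightarrow> (f i, g i) \<in> \<Gamma>"
  shows "(sum f A, sum g A) \<in> \<Gamma>"
  using assms by (induction A rule: infinite_finite_induct) (auto simp: dual_zero intro: dual_add)

text \<open>A pair stands for \<open>P + \<epsilon> Q\<close>, a polynomial over the ring of dual
  numbers \<Gamma>; hence the Leibniz form of \<open>dual_polys_mult\<close>.\<close>

definition dual_polys :: "(real poly \<times> real poly) set" where
  "dual_polys = {(P, Q). \<forall>n. (coeff P n, coeff Q n) \<in> \<Gamma>}"

lemma dual_polys_diff:
  "(P, P') \<in> dual_polys \<Longrightarrow> (Q, Q') \<in> dual_polys \<Longrightarrow> (P - Q, P' - Q') \<in> dual_polys"
  by (auto simp: dual_polys_def intro: dual_diff)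

lemma dual_polys_mult:
  assumes "(P, P') \<in> dual_polys" "(Q, Q') \<in> dual_polys"
  shows "(P * Q, P * Q' + P' * Q) \<in> dual_polys"
  using assms unfolding dual_polys_def
  by (auto simp: coeff_mult sum.distrib[symmetric] intro!: dual_sum dual_mult)

lemma dual_polys_const: "(c, c') \<in> \<Gamma> \<Longrightarrow> ([:c:], [:c':]) \<in> dual_polys"
  by (auto simp: dual_polys_def coeff_pCons dual_zero split: nat.splits)

lemma dual_polys_monom: "(c, c') \<in> \<Gamma> \<Longrightarrow> (monom c n, monom c' n) \<in> dual_polys"
  by (auto simp: dual_polys_def dual_zero)

lemma dual_polys_functional: "(0, Q) \<in> dual_polys \<Longrightarrow> Q = 0"
  by (auto simp: dual_polys_def poly_eq_iff intro: dual_functional)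

lemma dual_polys_pderiv: "(P, Q) \<in> dual_polys \<Longrightarrow> (pderiv P, pderiv Q) \<in> dual_polys"
proof -
  assume PQ: "(P, Q) \<in> dual_polys"
  have nat: "(of_nat n, 0) \<in> \<Gamma>" for n
    by (induction n) (auto simp: dual_zero dest: dual_add[OF dual_one])
  show ?thesis
    unfolding dual_polys_def
  proof (clarify)
    fix n
    show "(coeff (pderiv P) n, coeff (pderiv Q) n) \<in> \<Gamma>"
      using dual_mult[OF nat[of "Suc n"], of "coeff P (Suc n)" "coeff Q (Suc n)"] PQ
      by (simp add: dual_polys_def coeff_pderiv)
  qed
qed

text \<open>The value of \<open>P + \<epsilon> Q\<close> at the dual number \<open>a + \<epsilon> t\<close>.\<close>

definition dual_eval :: "real \<Rightarrow> real \<Rightarrow> real poly \<times> real poly \<Rightarrow> real \<times> real" where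
  "dual_eval a t = (\<lambda>(P, Q). (poly P a, poly Q a + t * poly (pderiv P) a))"

text \<open>Evaluation at \<open>a + \<epsilon> t\<close> is a ring homomorphism, so its image is a
  ring. The hypothesis makes the image the graph of a function: a polynomial relation satisfied by
  \<open>a\<close> has to survive differentiation.\<close>

lemma dual_subring_eval:
  assumes functional: "\<And>P Q. (P, Q) \<in> dual_polys \<Longrightarrow> poly P a = 0 \<Longrightarrow>
      poly Q a + t * poly (pderiv P) a = 0"
  shows "dual_subring (dual_eval a t ` dual_polys)"
  unfolding dual_subring_def
proof (intro conjI allI impI)
  show "(1, 0) \<in> dual_eval a t ` dual_polys"
    using dual_polys_const[OF dual_one] by (force simp: dual_eval_def pderiv_pCons)
next
  fix b assume "(0, b) \<in> dual_eval a t ` dual_polys"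
  then show "b = 0" using functional by (auto simp: dual_eval_def)
next
  fix x x' y y'
  assume "(x, x') \<in> dual_eval a t ` dual_polys" "(y, y') \<in> dual_eval a t ` dual_polys"
  then obtain P P' Q Q' where PQ: "(P, P') \<in> dual_polys" "(Q, Q') \<in> dual_polys"
    and x: "x = poly P a" "x' = poly P' a + t * poly (pderiv P) a"
    and y: "y = poly Q a" "y' = poly Q' a + t * poly (pderiv Q) a"
    by (auto simp: dual_eval_def)
  have "(x - y, x' - y') = dual_eval a t (P - Q, P' - Q')"
    unfolding x y dual_eval_def by (simp add: pderiv_diff algebra_simps)
  then show "(x - y, x' - y') \<in> dual_eval a t ` dual_polys"
    using dual_polys_diff[OF PQ] by blast
  have "(x * y, x * y' + x' * y) = dual_eval a t (P * Q, P * Q' + P' * Q)"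
    unfolding x y dual_eval_def by (simp add: pderiv_mult algebra_simps)
  then show "(x * y, x * y' + x' * y) \<in> dual_eval a t ` dual_polys"
    using dual_polys_mult[OF PQ] by blast
qed

text \<open>The coefficients form a ring, not a field, so division by the minimal polynomial
  \<open>M\<close> is replaced by pseudo-division: multiplication by the leading coefficient of
  \<open>M\<close> lets the top terms cancel without inverses.\<close>

lemma dual_eval_root:
  assumes M: "(M, M') \<in> dual_polys" "poly M a = 0" "M \<noteq> 0"
    and root: "poly M' a + t * poly (pderiv M) a = 0"
    and least: "\<And>P P'. (P, P') \<in> dual_polys \<Longrightarrow> poly P a = 0 \<Longrightarrow> P \<noteq> 0 \<Longrightarrow> degree M \<le> degree P"
    and P: "(P, P') \<in> dual_polys" "poly P a = 0"
  shows "poly P' a + t * poly (pderiv P) a = 0"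
  using P
proof (induction "degree P" arbitrary: P P' rule: less_induct)
  case less
  show ?case
  proof (cases "P = 0")
    case True
    then have "P' = 0" using less.prems(1) dual_polys_functional by blast
    then show ?thesis using True by simp
  next
    case False
    define k where "k = degree P - degree M"
    have deg: "degree M \<le> degree P" using least less.prems False by blast
    define l l' c c' where "l = lead_coeff M" and "l' = coeff M' (degree M)"
      and "c = lead_coeff P" and "c' = coeff P' (degree P)"
    have lc: "(l, l') \<in> \<Gamma>" "(c, c') \<in> \<Gamma>"
      using M(1) less.prems(1) by (auto simp: dual_polys_def l_def l'_def c_def c'_def)
    \<comment> \<open>The two parts of \<open>(l + \<epsilon> l') (P + \<epsilon> P') - (c +
      \<epsilon> c') X^k (M + \<epsilon> M')\<close>. The terms with \<open>l'\<close> and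
      \<open>c'\<close> vanish at \<open>a\<close> together with \<open>P\<close> and
      \<open>M\<close>.\<close>
    define Q Q' where "Q = [:l:] * P - monom c k * M"
      and "Q' = ([:l:] * P' + [:l':] * P) - (monom c k * M' + monom c' k * M)"
    have QQ: "(Q, Q') \<in> dual_polys"
      unfolding Q_def Q'_def using lc M(1) less.prems(1)
      by (intro dual_polys_diff dual_polys_mult dual_polys_const dual_polys_monom)
    have Qa: "poly Q a = 0" using M less.prems by (simp add: Q_def)
    have eq: "poly Q' a + t * poly (pderiv Q) a = l * (poly P' a + t * poly (pderiv P) a)
        - c * a ^ k * (poly M' a + t * poly (pderiv M) a)"
      using M(2) less.prems(2)
      by (simp add: Q_def Q'_def pderiv_diff pderiv_mult pderiv_smult poly_monom algebra_simps)
    have "poly Q' a + t * poly (pderiv Q) a = 0"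
    proof (cases "Q = 0")
      case True
      then have "Q' = 0" using QQ dual_polys_functional by blast
      then show ?thesis using True by simp
    next
      case Q0: False
      have dP: "degree P \<noteq> 0"
      proof
        assume "degree P = 0"
        then obtain c where "P = [:c:]" by (metis degree_eq_zeroE)
        then show False using less.prems(2) False by simp
      qed
      have "degree Q < degree P"
      proof (rule ccontr)
        assume "\<not> degree Q < degree P"
        moreover have "degree Q \<le> degree P"
          unfolding Q_def
        proof (rule degree_diff_le)
          show "degree ([:l:] * P) \<le> degree P" by (simp add: degree_smult_le)
          have "degree (monom c k * M) \<le> k + degree M"
            using degree_mult_le[of "monom c k" M] degree_monom_le[of c k] by linarith
          then show "degree (monom c k * M) \<le> degree P" using deg by (simp add: k_def)
        qed
        ultimately have "degree Q = degree P" by simp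
        moreover have "coeff Q (degree P) = 0"
          using deg by (simp add: Q_def coeff_monom_mult k_def l_def c_def)
        ultimately show False using Q0 by (metis leading_coeff_0_iff)
      qed
      then show ?thesis using less.hyps QQ Qa by blast
    qed
    then have "l * (poly P' a + t * poly (pderiv P) a) = 0"
      using eq root by simp
    then show ?thesis using M(3) by (simp add: l_def)
  qed
qed

lemma dual_subring_extend: "\<exists>\<Delta> t. dual_subring \<Delta> \<and> \<Gamma> \<subseteq> \<Delta> \<and> (a, t) \<in> \<Delta>"
proof -
  have "\<exists>t. \<forall>(P, Q) \<in> dual_polys. poly P a = 0 \<longrightarrow> poly Q a + t * poly (pderiv P) a = 0"
  proof (cases "\<exists>P Q. (P, Q) \<in> dual_polys \<and> poly P a = 0 \<and> P \<noteq> 0")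
    \<comment> \<open>Here \<open>a\<close> is transcendental over the ring, so its derivative is
      free; 0 is an arbitrary choice.\<close>
    case False
    then have "P = 0 \<and> Q = 0" if "(P, Q) \<in> dual_polys" "poly P a = 0" for P Q
      using that dual_polys_functional by blast
    then have "\<forall>(P, Q) \<in> dual_polys. poly P a = 0 \<longrightarrow> poly Q a + 0 * poly (pderiv P) a = 0"
      by fastforce
    then show ?thesis by (rule exI)
  next
    case True
    define A where "A = {x \<in> dual_polys. poly (fst x) a = 0 \<and> fst x \<noteq> 0}"
    obtain P Q where "(P, Q) \<in> A" using True by (auto simp: A_def)
    then obtain x where x: "x \<in> A" "\<And>y. y \<in> A \<Longrightarrow> degree (fst x) \<le> degree (fst y)"
      using ex_has_least_nat[of "\<lambda>x. x \<in> A" "(P, Q)" "\<lambda>x. degree (fst x)"] by blast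
    obtain M M' where xM: "x = (M, M')" by force
    have M: "(M, M') \<in> dual_polys" "poly M a = 0" "M \<noteq> 0"
      using x(1) xM by (auto simp: A_def)
    have least: "degree M \<le> degree P" if "(P, P') \<in> dual_polys" "poly P a = 0" "P \<noteq> 0" for P P'
      using x(2)[of "(P, P')"] that xM by (auto simp: A_def)
    have dM: "degree M \<noteq> 0"
    proof
      assume "degree M = 0"
      then obtain c where "M = [:c:]" by (metis degree_eq_zeroE)
      then show False using M by simp
    qed
    \<comment> \<open>In characteristic 0 the derivative is a nonzero polynomial of smaller degree,
      so a root at \<open>a\<close> would contradict minimality.\<close>
    have "poly (pderiv M) a \<noteq> 0"
    proof
      assume "poly (pderiv M) a = 0"
      moreover have "pderiv M \<noteq> 0" using dM by (simp add: pderiv_eq_0_iff)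
      ultimately have "degree M \<le> degree (pderiv M)"
        using least dual_polys_pderiv M(1) by blast
      then show False using dM by (simp add: degree_pderiv)
    qed
    \<comment> \<open>Differentiating the relation given by \<open>M\<close> at \<open>a\<close>
      forces this value.\<close>
    define t where "t = - poly M' a / poly (pderiv M) a"
    have "poly M' a + t * poly (pderiv M) a = 0"
      using \<open>poly (pderiv M) a \<noteq> 0\<close> by (simp add: t_def)
    then have "poly P' a + t * poly (pderiv P) a = 0" if "(P, P') \<in> dual_polys" "poly P a = 0" for P P'
      by (rule dual_eval_root[OF M _ _ that]) (rule least)
    then show ?thesis by (intro exI[of _ t]) auto
  qed
  then obtain t where t: "\<And>P Q. (P, Q) \<in> dual_polys \<Longrightarrow> poly P a = 0 \<Longrightarrow>
      poly Q a + t * poly (pderiv P) a = 0" by blast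
  let ?\<Delta> = "dual_eval a t ` dual_polys"
  have "\<Gamma> \<subseteq> ?\<Delta>"
  proof
    fix z assume "z \<in> \<Gamma>"
    then have "([:fst z:], [:snd z:]) \<in> dual_polys" by (simp add: dual_polys_const)
    then show "z \<in> ?\<Delta>" by (force simp: dual_eval_def pderiv_pCons)
  qed
  moreover have "(a, t) \<in> ?\<Delta>"
    using dual_polys_monom[OF dual_one, of 1]
    by (force simp: dual_eval_def poly_monom pderiv_monom)
  ultimately show ?thesis using dual_subring_eval[OF t] by blast
qed

end

text \<open>In a maximal graph every real occurs as a first component, since
  \<open>dual_subring_extend\<close> could adjoin any missing one. Such a graph is a derivation on
  all of the reals.\<close>

lemma dual_subring_derivation:
  assumes "dual_subring \<Gamma>"
  obtains D where "derivation D" "\<And>a a'. (a, a') \<in> \<Gamma> \<Longrightarrow> D a = a'"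
proof -
  define \<A> where "\<A> = {\<Delta>. dual_subring \<Delta> \<and> \<Gamma> \<subseteq> \<Delta>}"
  have "\<exists>M\<in>\<A>. \<forall>X\<in>\<A>. M \<subseteq> X \<longrightarrow> X = M"
  proof (rule subset_Zorn_nonempty)
    show "\<A> \<noteq> {}" using assms by (auto simp: \<A>_def)
  next
    fix \<C> assume ne: "\<C> \<noteq> {}" and ch: "subset.chain \<A> \<C>"
    then have C: "\<And>\<Delta>. \<Delta> \<in> \<C> \<Longrightarrow> dual_subring \<Delta> \<and> \<Gamma> \<subseteq> \<Delta>"
      unfolding \<A>_def subset.chain_def by blast
    have two: "\<exists>\<Delta>\<in>\<C>. x \<in> \<Delta> \<and> y \<in> \<Delta>" if "x \<in> \<Union>\<C>" "y \<in> \<Union>\<C>" for x y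
      using that ch unfolding subset.chain_def by blast
    have "dual_subring (\<Union>\<C>)"
      unfolding dual_subring_def
    proof (intro conjI allI impI)
      show "(1, 0) \<in> \<Union>\<C>" using ne C by (meson UnionI dual_one ex_in_conv)
    next
      fix a a' b b' assume "(a, a') \<in> \<Union>\<C>" "(b, b') \<in> \<Union>\<C>"
      then obtain \<Delta> where "\<Delta> \<in> \<C>" "(a, a') \<in> \<Delta>" "(b, b') \<in> \<Delta>" using two by blast
      then show "(a - b, a' - b') \<in> \<Union>\<C>" "(a * b, a * b' + a' * b) \<in> \<Union>\<C>"
        using C dual_diff dual_mult by blast+
    next
      fix b assume "(0, b) \<in> \<Union>\<C>"
      then show "b = 0" using C dual_functional by blast
    qed
    then show "\<Union>\<C> \<in> \<A>" using ne C by (auto simp: \<A>_def)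
  qed
  then obtain M where M: "dual_subring M" "\<Gamma> \<subseteq> M"
    and max: "\<And>X. dual_subring X \<Longrightarrow> M \<subseteq> X \<Longrightarrow> X = M"
    by (auto simp: \<A>_def)
  have ex: "\<exists>t. (a, t) \<in> M" for a
    using dual_subring_extend[OF M(1), of a] max by blast
  have unique: "t = t'" if "(a, t) \<in> M" "(a, t') \<in> M" for a t t'
    using dual_functional[OF M(1), of "t - t'"] dual_diff[OF M(1) that] by simp
  define D where "D a = (SOME t. (a, t) \<in> M)" for a
  have D: "(a, D a) \<in> M" for a unfolding D_def using ex by (rule someI_ex)
  have "derivation D"
    unfolding derivation_def
    using unique[OF D dual_add[OF M(1) D D]] unique[OF D dual_mult[OF M(1) D D]] by blast
  moreover have "D a = a'" if "(a, a') \<in> \<Gamma>" for a a'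
    using that M(2) unique[OF D] by blast
  ultimately show thesis by (rule that)
qed

section \<open>Linear algebra\<close>

text \<open>An indexed family is independent without repetitions exactly if every system of inner
  products with it is solvable. This is one direction and \<open>independent_familyI\<close> the
  other; solvability is the form that derivations transport.\<close>

lemma independent_family_solve:
  fixes z :: "'k \<Rightarrow> 'a::euclidean_space"
  assumes "inj_on z S" "independent (z ` S)"
  obtains w where "\<And>k. k \<in> S \<Longrightarrow> z k \<bullet> w = c k"
proof -
  obtain g :: "'a \<Rightarrow> real" where g: "linear g" "\<forall>x\<in>z ` S. g x = c (inv_into S z x)"
    using linear_independent_extend[OF assms(2), of "\<lambda>x. c (inv_into S z x)"] by blast
  have "z k \<bullet> adjoint g 1 = c k" if "k \<in> S" for k
    using adjoint_works[OF g(1), of "z k" 1] g(2) that assms(1) by simp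
  then show thesis using that by blast
qed

lemma independent_familyI:
  fixes z :: "'k \<Rightarrow> 'a::euclidean_space"
  assumes solve: "\<And>c. \<exists>w. \<forall>k\<in>S. z k \<bullet> w = c k"
  shows "inj_on z S" "independent (z ` S)"
proof -
  show inj: "inj_on z S"
  proof (rule inj_onI, rule ccontr)
    fix k k' assume k: "k \<in> S" "k' \<in> S" "z k = z k'" "k \<noteq> k'"
    obtain w where "\<forall>j\<in>S. z j \<bullet> w = (if j = k then 1 else 0)"
      using solve[of "\<lambda>j. if j = k then 1 else 0"] by blast
    then have "z k \<bullet> w = 1" "z k' \<bullet> w = 0" using k(1,2,4) by auto
    then show False using k(3) by simp
  qed
  show "independent (z ` S)"
    unfolding dependent_def
  proof clarify
    fix k assume k: "k \<in> S" "z k \<in> span (z ` S - {z k})"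
    obtain w where w: "\<forall>j\<in>S. z j \<bullet> w = (if j = k then 1 else 0)"
      using solve[of "\<lambda>j. if j = k then 1 else 0"] by blast
    then have "orthogonal w y" if "y \<in> z ` S - {z k}" for y
      using that by (auto simp: orthogonal_def inner_commute)
    then have "orthogonal w (z k)" using k(2) orthogonal_to_span by blast
    then show False using w k(1) by (auto simp: orthogonal_def inner_commute)
  qed
qed

text \<open>Adding only vectors of \<open>Basis\<close> keeps the new rows constant with entries 0
  and 1, so determinants remain integer polynomials. The bijection \<sigma> allows values attached
  to the vectors of \<open>B\<close> to be stored in orthonormal coordinates.\<close>

lemma independent_extend_Basis:
  fixes B0 :: "'a::euclidean_space set"
  assumes "independent B0"
  obtains B \<sigma> where "B0 \<subseteq> B" "B \<subseteq> B0 \<union> Basis" "finite B" "independent B" "span B = UNIV"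
    "bij_betw \<sigma> B (Basis :: 'a set)"
proof -
  obtain B where B: "B0 \<subseteq> B" "B \<subseteq> B0 \<union> Basis" "independent B" "B0 \<union> Basis \<subseteq> span B"
    using maximal_independent_subset_extend[of B0 "B0 \<union> Basis"] assms by auto
  then have sB: "span B = UNIV"
    by (metis le_sup_iff span_Basis span_minimal subspace_span top.extremum_uniqueI)
  have "finite B" using B(3) independent_bound by blast
  moreover have "card B = card (Basis :: 'a set)"
    using basis_card_eq_dim[OF _ _ B(3), of UNIV] sB by auto
  ultimately obtain \<sigma> where "bij_betw \<sigma> B (Basis :: 'a set)"
    using finite_same_card_bij[of B "Basis :: 'a set"] finite_Basis by blast
  then show thesis by (rule that[OF B(1,2) \<open>finite B\<close> B(3) sB])
qed

section \<open>Integer polynomial functions at generic points\<close>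

text \<open>Polynomials are treated as functions, so that determinants need no normal forms.
  Subtraction as a constructor yields zero, negation and addition.\<close>

inductive_set int_polys :: "'i set \<Rightarrow> (('i \<Rightarrow> real) \<Rightarrow> real) set" for I where
  one: "(\<lambda>_. 1) \<in> int_polys I"
| var: "i \<in> I \<Longrightarrow> (\<lambda>y. y i) \<in> int_polys I"
| diff: "\<phi> \<in> int_polys I \<Longrightarrow> \<psi> \<in> int_polys I \<Longrightarrow> (\<lambda>y. \<phi> y - \<psi> y) \<in> int_polys I"
| mult: "\<phi> \<in> int_polys I \<Longrightarrow> \<psi> \<in> int_polys I \<Longrightarrow> (\<lambda>y. \<phi> y * \<psi> y) \<in> int_polys I"

lemma int_polys_zero: "(\<lambda>_. 0) \<in> int_polys I"
  using int_polys.diff[OF int_polys.one int_polys.one] by simp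

lemma int_polys_uminus: "\<phi> \<in> int_polys I \<Longrightarrow> (\<lambda>y. - \<phi> y) \<in> int_polys I"
  using int_polys.diff[OF int_polys_zero] by simp

lemma int_polys_add:
  "\<phi> \<in> int_polys I \<Longrightarrow> \<psi> \<in> int_polys I \<Longrightarrow> (\<lambda>y. \<phi> y + \<psi> y) \<in> int_polys I"
  using int_polys.diff[OF _ int_polys_uminus] by fastforce

lemma int_polys_sum:
  assumes "\<And>a. a \<in> A \<Longrightarrow> \<phi> a \<in> int_polys I"
  shows "(\<lambda>y. \<Sum>a\<in>A. \<phi> a y) \<in> int_polys I"
  using assms
  by (induction A rule: infinite_finite_induct) (auto intro: int_polys_zero int_polys_add)

lemma int_polys_prod:
  assumes "\<And>a. a \<in> A \<Longrightarrow> \<phi> a \<in> int_polys I"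
  shows "(\<lambda>y. \<Prod>a\<in>A. \<phi> a y) \<in> int_polys I"
  using assms
  by (induction A rule: infinite_finite_induct) (auto intro: int_polys.one int_polys.mult)

lemma int_polys_sign: "(\<lambda>_. of_int (sign \<pi>)) \<in> int_polys I"
  by (auto simp: sign_def intro: int_polys.one int_polys_uminus)

lemma int_polys_det:
  fixes A :: "('i \<Rightarrow> real) \<Rightarrow> real^'n^'n"
  assumes "\<And>k l. (\<lambda>y. A y $ k $ l) \<in> int_polys I"
  shows "(\<lambda>y. det (A y)) \<in> int_polys I"
  unfolding det_def
  by (intro int_polys_sum int_polys.mult int_polys_sign int_polys_prod assms)

section \<open>From polynomial functions to formal polynomials\<close>

definition monom_eval :: "('i \<Rightarrow> real) \<Rightarrow> ('i \<Rightarrow>\<^sub>0 nat) \<Rightarrow> real" where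
  "monom_eval y m = (\<Prod>i \<in> Poly_Mapping.keys m. y i ^ Poly_Mapping.lookup m i)"

lemma monom_eval_superset:
  assumes "finite A" "Poly_Mapping.keys m \<subseteq> A"
  shows "monom_eval y m = (\<Prod>i\<in>A. y i ^ Poly_Mapping.lookup m i)"
  unfolding monom_eval_def using assms
  by (intro prod.mono_neutral_left) (auto simp: in_keys_iff)

lemma monom_eval_add: "monom_eval y (m + m') = monom_eval y m * monom_eval y m'"
proof -
  let ?A = "Poly_Mapping.keys m \<union> Poly_Mapping.keys m'"
  have "monom_eval y (m + m') = (\<Prod>i\<in>?A. y i ^ Poly_Mapping.lookup (m + m') i)"
    by (intro monom_eval_superset) (auto simp: Poly_Mapping.keys_add)
  also have "\<dots> = (\<Prod>i\<in>?A. y i ^ Poly_Mapping.lookup m i) * (\<Prod>i\<in>?A. y i ^ Poly_Mapping.lookup m' i)"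
    by (simp add: lookup_add power_add prod.distrib)
  also have "\<dots> = monom_eval y m * monom_eval y m'"
    by (simp add: monom_eval_superset[of ?A])
  finally show ?thesis .
qed

lemma mpoly_eval_superset:
  assumes "finite A" "Poly_Mapping.keys P \<subseteq> A"
  shows "mpoly_eval y P = (\<Sum>m\<in>A. of_rat (Poly_Mapping.lookup P m) * monom_eval y m)"
  unfolding mpoly_eval_def monom_eval_def[symmetric] using assms
  by (intro sum.mono_neutral_left) (auto simp: in_keys_iff)

lemma mpoly_eval_add: "mpoly_eval y (P + Q) = mpoly_eval y P + mpoly_eval y Q"
proof -
  let ?A = "Poly_Mapping.keys P \<union> Poly_Mapping.keys Q"
  have "mpoly_eval y (P + Q) = (\<Sum>m\<in>?A. of_rat (Poly_Mapping.lookup (P + Q) m) * monom_eval y m)"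
    by (intro mpoly_eval_superset) (auto simp: Poly_Mapping.keys_add)
  then show ?thesis
    by (simp add: mpoly_eval_superset[of ?A] lookup_add of_rat_add distrib_right sum.distrib)
qed

lemma keys_uminus_poly_mapping:
  "Poly_Mapping.keys (- P :: 'a \<Rightarrow>\<^sub>0 'b::ab_group_add) = Poly_Mapping.keys P"
  by (auto simp: in_keys_iff)

lemma mpoly_eval_uminus: "mpoly_eval y (- P) = - mpoly_eval y P"
  by (simp add: mpoly_eval_def keys_uminus_poly_mapping of_rat_minus sum_negf)

lemma mpoly_eval_single: "mpoly_eval y (Poly_Mapping.single m c) = of_rat c * monom_eval y m"
  by (simp add: mpoly_eval_superset[of "{m}"] split: if_splits)

lemma mpoly_eval_sum: "mpoly_eval y (\<Sum>a\<in>A. P a) = (\<Sum>a\<in>A. mpoly_eval y (P a))"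
  by (induction A rule: infinite_finite_induct) (auto simp: mpoly_eval_add, auto simp: mpoly_eval_def)

lemma mpoly_vars_add: "mpoly_vars (P + Q) \<subseteq> mpoly_vars P \<union> mpoly_vars Q"
  unfolding mpoly_vars_def using Poly_Mapping.keys_add[of P Q] by blast

lemma mpoly_vars_sum: "(\<And>a. a \<in> A \<Longrightarrow> mpoly_vars (P a) \<subseteq> I) \<Longrightarrow> mpoly_vars (\<Sum>a\<in>A. P a) \<subseteq> I"
proof (induction A rule: infinite_finite_induct)
  case (insert a A)
  then show ?case using mpoly_vars_add[of "P a" "sum P A"] by auto
qed (auto simp: mpoly_vars_def)

lemma int_polys_mpoly:
  assumes "\<phi> \<in> int_polys I"
  shows "\<exists>P. mpoly_vars P \<subseteq> I \<and> (\<forall>y. mpoly_eval y P = \<phi> y)"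
  using assms
proof induction
  case one
  show ?case
    by (rule exI[of _ "Poly_Mapping.single 0 1"])
       (simp add: mpoly_eval_single[of _ 0 1, simplified] monom_eval_def mpoly_vars_def)
next
  case (var i)
  then show ?case
    by (intro exI[of _ "Poly_Mapping.single (Poly_Mapping.single i 1) 1"])
       (auto simp: mpoly_eval_single monom_eval_def mpoly_vars_def)
next
  case (diff \<phi> \<psi>)
  then obtain P Q where "mpoly_vars P \<subseteq> I" "\<forall>y. mpoly_eval y P = \<phi> y"
    "mpoly_vars Q \<subseteq> I" "\<forall>y. mpoly_eval y Q = \<psi> y" by blast
  moreover have "mpoly_vars (- Q) = mpoly_vars Q" by (simp add: mpoly_vars_def keys_uminus_poly_mapping)
  ultimately show ?case
    using mpoly_vars_add[of P "- Q"]
    by (intro exI[of _ "P + - Q"])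
       (auto simp: mpoly_eval_add mpoly_eval_uminus simp del: add_uminus_conv_diff)
next
  case (mult \<phi> \<psi>)
  then obtain P Q where P: "mpoly_vars P \<subseteq> I" "\<forall>y. mpoly_eval y P = \<phi> y"
    and Q: "mpoly_vars Q \<subseteq> I" "\<forall>y. mpoly_eval y Q = \<psi> y" by blast
  let ?R = "\<Sum>m\<in>Poly_Mapping.keys P. \<Sum>m'\<in>Poly_Mapping.keys Q.
    Poly_Mapping.single (m + m') (Poly_Mapping.lookup P m * Poly_Mapping.lookup Q m')"
  have "mpoly_eval y ?R = mpoly_eval y P * mpoly_eval y Q" for y
    unfolding mpoly_eval_sum mpoly_eval_single
      mpoly_eval_superset[OF finite_keys order_refl, of _ P]
      mpoly_eval_superset[OF finite_keys order_refl, of _ Q]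
    by (simp add: monom_eval_add sum_product of_rat_mult mult_ac)
  moreover have "mpoly_vars ?R \<subseteq> I"
  proof (intro mpoly_vars_sum)
    fix m m' assume "m \<in> Poly_Mapping.keys P" "m' \<in> Poly_Mapping.keys Q"
    then have "Poly_Mapping.keys m \<subseteq> I" "Poly_Mapping.keys m' \<subseteq> I"
      using P Q by (auto simp: mpoly_vars_def)
    then show "mpoly_vars (Poly_Mapping.single (m + m') (Poly_Mapping.lookup P m * Poly_Mapping.lookup Q m')) \<subseteq> I"
      using Poly_Mapping.keys_add[of m m'] by (auto simp: mpoly_vars_def split: if_splits)
  qed
  ultimately show ?case using P Q by auto
qed

text \<open>Read contrapositively: a polynomial that is nonzero at one point, however special, is
  nonzero at the generic one. Rank statements about generic frameworks thus reduce to finding one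
  good special point.\<close>

lemma alg_independent_int_poly:
  assumes "alg_independent I x" "\<phi> \<in> int_polys I" "\<phi> x = 0"
  shows "\<phi> y = 0"
proof -
  obtain P where P: "mpoly_vars P \<subseteq> I" "\<forall>y. mpoly_eval y P = \<phi> y"
    using int_polys_mpoly[OF assms(2)] by blast
  then have "P = 0" using assms by (auto simp: alg_independent_def)
  then show ?thesis using P by (force simp: mpoly_eval_def)
qed

lemma alg_independent_derivation:
  assumes "alg_independent I x"
  obtains D where "derivation D" "\<And>i. i \<in> I \<Longrightarrow> D (x i) = c i"
proof -
  let ?\<gamma> = "\<lambda>\<phi> t. \<phi> (\<lambda>i. x i + t * c i)"
  \<comment> \<open>On the ring generated by the \<open>x i\<close> the derivation is the
    directional derivative along \<open>c\<close>. Differentiability is part of the definition, so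
    closure under the ring operations is given by the differentiation rules.\<close>
  define \<Gamma> where "\<Gamma> = {(\<phi> x, d) | \<phi> d. \<phi> \<in> int_polys I \<and> (?\<gamma> \<phi> has_real_derivative d) (at 0)}"
  have \<Gamma>I: "(a, d) \<in> \<Gamma>" if "\<phi> \<in> int_polys I" "(?\<gamma> \<phi> has_real_derivative d) (at 0)" "a = \<phi> x" for \<phi> a d
    using that by (auto simp: \<Gamma>_def)
  have "dual_subring \<Gamma>"
    unfolding dual_subring_def
  proof (intro conjI allI impI)
    show "(1, 0) \<in> \<Gamma>" by (rule \<Gamma>I[OF int_polys.one]) auto
  next
    fix a a' b b' assume "(a, a') \<in> \<Gamma>" "(b, b') \<in> \<Gamma>"
    then obtain \<phi> \<psi> where \<phi>: "\<phi> \<in> int_polys I" "(?\<gamma> \<phi> has_real_derivative a') (at 0)" "a = \<phi> x"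
      and \<psi>: "\<psi> \<in> int_polys I" "(?\<gamma> \<psi> has_real_derivative b') (at 0)" "b = \<psi> x"
      by (auto simp: \<Gamma>_def)
    have "(?\<gamma> (\<lambda>y. \<phi> y - \<psi> y) has_real_derivative a' - b') (at 0)"
      using \<phi> \<psi> by (intro derivative_intros)
    then show "(a - b, a' - b') \<in> \<Gamma>"
      using \<phi>(3) \<psi>(3) by (intro \<Gamma>I[OF int_polys.diff[OF \<phi>(1) \<psi>(1)]]) simp_all
    have "(?\<gamma> (\<lambda>y. \<phi> y * \<psi> y) has_real_derivative a * b' + a' * b) (at 0)"
      using DERIV_mult[OF \<phi>(2) \<psi>(2)] \<phi>(3) \<psi>(3) by (simp add: mult.commute add.commute)
    then show "(a * b, a * b' + a' * b) \<in> \<Gamma>"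
      using \<phi>(3) \<psi>(3) by (intro \<Gamma>I[OF int_polys.mult[OF \<phi>(1) \<psi>(1)]]) simp_all
  next
    fix b assume "(0, b) \<in> \<Gamma>"
    then obtain \<phi> where \<phi>: "\<phi> \<in> int_polys I" "(?\<gamma> \<phi> has_real_derivative b) (at 0)" "\<phi> x = 0"
      by (auto simp: \<Gamma>_def)
    \<comment> \<open>Well-definedness rests on algebraic independence: only the zero function takes
      the value 0 at \<open>x\<close>.\<close>
    then have "?\<gamma> \<phi> = (\<lambda>_. 0)" using alg_independent_int_poly[OF assms] by blast
    then show "b = 0" using \<phi>(2) by (metis DERIV_const DERIV_unique)
  qed
  then obtain D where D: "derivation D" "\<And>a a'. (a, a') \<in> \<Gamma> \<Longrightarrow> D a = a'"
    by (rule dual_subring_derivation) blast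
  have "(x i, c i) \<in> \<Gamma>" if "i \<in> I" for i
  proof -
    have "(?\<gamma> (\<lambda>y. y i) has_real_derivative c i) (at 0)"
      by (auto intro!: derivative_eq_intros)
    then show ?thesis by (intro \<Gamma>I[OF int_polys.var[OF that]]) simp_all
  qed
  then show thesis using that D by blast
qed

text \<open>The family at \<open>y\<close> is completed to a basis by coordinate vectors. The
  determinant of the resulting matrix is an integer polynomial, nonzero at \<open>y\<close> and
  hence at the generic \<open>x\<close>, where the rows include the family in question.\<close>

lemma generic_independent:
  fixes z :: "'j \<Rightarrow> ('i \<Rightarrow> real) \<Rightarrow> real^'n"
  assumes x: "alg_independent I x"
    and z: "\<And>j k. j \<in> J \<Longrightarrow> (\<lambda>y. z j y $ k) \<in> int_polys I"
    and y: "inj_on (\<lambda>j. z j y) J" "independent ((\<lambda>j. z j y) ` J)"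
  shows "inj_on (\<lambda>j. z j x) J" "independent ((\<lambda>j. z j x) ` J)"
proof -
  define B0 where "B0 = (\<lambda>j. z j y) ` J"
  obtain B \<tau> where B: "B0 \<subseteq> B" "B \<subseteq> B0 \<union> Basis" "finite B" and sB: "span B = UNIV"
    and \<tau>: "bij_betw \<tau> B (Basis :: (real^'n) set)"
    by (rule independent_extend_Basis[OF y(2)[folded B0_def]])
  have "card B = CARD('n)" using bij_betw_same_card[OF \<tau>] by simp
  then obtain \<sigma> :: "'n \<Rightarrow> real^'n" where \<sigma>: "bij_betw \<sigma> UNIV B"
    using finite_same_card_bij[of "UNIV :: 'n set" B] B(3) by auto
  define r where "r k v = (if \<sigma> k \<in> B0 then z (inv_into J (\<lambda>j. z j y) (\<sigma> k)) v else \<sigma> k)" for k v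
  define A where "A v = (\<chi> k. r k v)" for v
  have A_poly: "(\<lambda>v. A v $ k $ l) \<in> int_polys I" for k l
  proof (cases "\<sigma> k \<in> B0")
    case True
    then have "inv_into J (\<lambda>j. z j y) (\<sigma> k) \<in> J" unfolding B0_def by (rule inv_into_into)
    then show ?thesis using True z by (simp add: A_def r_def)
  next
    case False
    then have "\<sigma> k \<in> Basis" using \<sigma> B(2) bij_betwE by blast
    then obtain i where "\<sigma> k = axis i 1" by (auto simp: Basis_vec_def)
    then show ?thesis
      using False by (simp add: A_def r_def axis_def int_polys.one int_polys_zero)
  qed
  have "r k y = \<sigma> k" for k
    unfolding r_def B0_def by (simp add: f_inv_into_f[of _ "\<lambda>j. z j y"])
  then have "rows (A y) = B"
    using \<sigma> by (auto simp: rows_def row_def A_def bij_betw_def vec_nth_inverse)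
  then have "invertible (A y)"
    using sB matrix_left_invertible_span_rows[of "A y"] invertible_left_inverse by metis
  then have "det (A y) \<noteq> 0" by (simp add: invertible_det_nz)
  then have det: "det (A x) \<noteq> 0"
    using alg_independent_int_poly[OF x int_polys_det[OF A_poly]] by blast
  have row: "\<exists>k. \<sigma> k = z j y \<and> row k (A x) = z j x" if "j \<in> J" for j
  proof -
    have "z j y \<in> B" using that B(1) by (auto simp: B0_def)
    then obtain k where k: "\<sigma> k = z j y" using \<sigma> by (metis bij_betw_imp_surj_on imageE)
    then show ?thesis
      using that y(1)
      by (intro exI[of _ k])
        (simp add: row_def A_def r_def B0_def vec_nth_inverse inv_into_f_f[of "\<lambda>j. z j y"])
  qed
  show "inj_on (\<lambda>j. z j x) J"
  proof (rule inj_onI)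
    fix j j' assume j: "j \<in> J" "j' \<in> J" "z j x = z j' x"
    obtain k k' where k: "\<sigma> k = z j y" "row k (A x) = z j x" "\<sigma> k' = z j' y" "row k' (A x) = z j' x"
      using row j by meson
    then have "k = k'" using det det_identical_rows[of k k' "A x"] j by metis
    then show "j = j'" using k j y(1) by (metis inj_onD)
  qed
  have "(\<lambda>j. z j x) ` J \<subseteq> rows (A x)"
  proof (rule image_subsetI)
    fix j assume "j \<in> J"
    then obtain k where "z j x = row k (A x)" using row by metis
    then show "z j x \<in> rows (A x)" by (auto simp: rows_def)
  qed
  moreover have "independent (rows (A x))"
    using det det_dependent_rows[of "A x"] by (auto simp: dependent_vec_eq)
  ultimately show "independent ((\<lambda>j. z j x) ` J)"
    by (rule independent_mono[rotated])
qed

section \<open>Level sets of constant rank\<close>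

text \<open>Near \<open>x\<close> the functions indexed by \<open>S\<close> are part of a chart,
  completed by linear coordinates. A segment of the chart with constant \<open>S\<close>-coordinates
  has velocity orthogonal to their gradients. By the rank bound these span all gradients, so every
  \<open>f k\<close> is constant along the segment. If the chart has further coordinates, moving
  along one of them gives the second point.\<close>

lemma constant_rank_level_set:
  fixes f :: "'k \<Rightarrow> 'a::euclidean_space \<Rightarrow> real" and G :: "'k \<Rightarrow> 'a \<Rightarrow> 'a"
  assumes K: "finite K" "S \<subseteq> K"
    and deriv: "\<And>k y. k \<in> K \<Longrightarrow> (f k has_derivative (\<lambda>h. G k y \<bullet> h)) (at y)"
    and cont: "\<And>k. k \<in> K \<Longrightarrow> continuous_on UNIV (G k)"
    and indep: "inj_on (\<lambda>k. G k x) S" "independent ((\<lambda>k. G k x) ` S)"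
    and rank: "\<And>y. dim ((\<lambda>k. G k y) ` K) \<le> card S"
  obtains U where "open U" "x \<in> U"
    "\<And>y k. y \<in> U \<Longrightarrow> (\<And>j. j \<in> S \<Longrightarrow> f j y = f j x) \<Longrightarrow> k \<in> K \<Longrightarrow> f k y = f k x"
    "card S < DIM('a) \<Longrightarrow> \<exists>y\<in>U. y \<noteq> x \<and> (\<forall>j\<in>S. f j y = f j x)"
proof -
  define B0 where "B0 = (\<lambda>k. G k x) ` S"
  obtain B \<sigma> where B: "B0 \<subseteq> B" "B \<subseteq> B0 \<union> Basis" "finite B" "independent B" "span B = UNIV"
    and \<sigma>: "bij_betw \<sigma> B (Basis :: 'a set)"
    using independent_extend_Basis[of B0] indep B0_def by auto
  define C where "C = B - B0"
  have finS: "finite S" using K finite_subset by blast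
  have finC: "finite C" using B(3) by (simp add: C_def)
  have GB: "G k x \<in> B" if "k \<in> S" for k using B(1) that by (auto simp: B0_def)
  have inner_\<sigma>: "\<sigma> b \<bullet> \<sigma> b' = (if b = b' then 1 else 0)" if "b \<in> B" "b' \<in> B" for b b'
  proof -
    have "\<sigma> b \<in> Basis" "\<sigma> b' \<in> Basis" "\<sigma> b = \<sigma> b' \<longleftrightarrow> b = b'"
      using that \<sigma> by (auto simp: bij_betw_def inj_on_eq_iff)
    then show ?thesis by (simp add: inner_Basis)
  qed
  \<comment> \<open>Packs the values \<open>a\<close> and the linear coordinates along
    \<open>C\<close> into one vector, from which \<open>\<Theta>_S\<close> and
    \<open>\<Theta>_C\<close> read them off.\<close>
  define \<Theta> where "\<Theta> a y = (\<Sum>k\<in>S. a k *\<^sub>R \<sigma> (G k x)) + (\<Sum>b\<in>C. (b \<bullet> y) *\<^sub>R \<sigma> b)" for a and y :: 'a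
  have \<Theta>_S: "\<Theta> a y \<bullet> \<sigma> (G k x) = a k" if k: "k \<in> S" for a y k
  proof -
    have "\<Theta> a y \<bullet> \<sigma> (G k x) = (\<Sum>j\<in>S. if j = k then a j else 0) + (\<Sum>b\<in>C. 0)"
      unfolding \<Theta>_def inner_add_left inner_sum_left inner_scaleR_left
    proof (intro arg_cong2[of _ _ _ _ "(+)"] sum.cong refl)
      fix j assume "j \<in> S"
      then show "a j * (\<sigma> (G j x) \<bullet> \<sigma> (G k x)) = (if j = k then a j else 0)"
        using inner_\<sigma>[OF GB GB] k indep(1) by (auto simp: inj_on_def)
    next
      fix b assume b: "b \<in> C"
      then have "b \<noteq> G k x" "b \<in> B" using k by (auto simp: C_def B0_def)
      then show "(b \<bullet> y) * (\<sigma> b \<bullet> \<sigma> (G k x)) = 0" using inner_\<sigma>[OF _ GB[OF k]] by simp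
    qed
    then show ?thesis using k finS by simp
  qed
  have \<Theta>_C: "\<Theta> a y \<bullet> \<sigma> c = c \<bullet> y" if c: "c \<in> C" for a y c
  proof -
    have cB: "c \<in> B" using c by (simp add: C_def)
    have "\<Theta> a y \<bullet> \<sigma> c = (\<Sum>j\<in>S. 0) + (\<Sum>b\<in>C. if b = c then b \<bullet> y else 0)"
      unfolding \<Theta>_def inner_add_left inner_sum_left inner_scaleR_left
    proof (intro arg_cong2[of _ _ _ _ "(+)"] sum.cong refl)
      fix j assume "j \<in> S"
      then have "G j x \<noteq> c" using c by (auto simp: C_def B0_def)
      then show "a j * (\<sigma> (G j x) \<bullet> \<sigma> c) = 0" using inner_\<sigma>[OF GB cB] \<open>j \<in> S\<close> by simp
    next
      fix b assume b: "b \<in> C"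
      then show "(b \<bullet> y) * (\<sigma> b \<bullet> \<sigma> c) = (if b = c then b \<bullet> y else 0)"
        using inner_\<sigma>[OF _ cB, of b] by (simp add: C_def)
    qed
    then show ?thesis using c finC by simp
  qed
  define \<Psi> where "\<Psi> y = \<Theta> (\<lambda>k. f k y) y" for y
  define D where "D y h = \<Theta> (\<lambda>k. G k y \<bullet> h) h" for y h
  have lin: "bounded_linear (D y)" for y
    unfolding D_def \<Theta>_def
    by (intro bounded_linear_add bounded_linear_sum bounded_linear_compose[OF bounded_linear_scaleR_left]
        bounded_linear_inner_right)
  have der: "(\<Psi> has_derivative D y) (at y)" for y
    unfolding \<Psi>_def D_def \<Theta>_def
    using K by (auto intro!: derivative_eq_intros deriv)
  have contD: "continuous_on UNIV (\<lambda>y. Blinfun (D y))"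
    using cont K(2)
    by (intro continuous_on_blinfun_componentwise)
       (auto simp: bounded_linear_Blinfun_apply[OF lin] D_def \<Theta>_def intro!: continuous_intros)
  have "inj (D x)"
  proof (rule linear_injective_0[THEN iffD2, rule_format])
    show "linear (D x)" using lin bounded_linear.linear by blast
    fix h assume h: "D x h = 0"
    have "orthogonal h b" if "b \<in> B" for b
    proof (cases "b \<in> B0")
      case True
      then obtain k where k: "k \<in> S" "b = G k x" by (auto simp: B0_def)
      then show ?thesis using \<Theta>_S[OF k(1), of "\<lambda>k. G k x \<bullet> h" h] h
        by (simp add: D_def orthogonal_def inner_commute)
    next
      case False
      then have "b \<in> C" using that by (simp add: C_def)
      then show ?thesis using \<Theta>_C[of b "\<lambda>k. G k x \<bullet> h" h] h
        by (simp add: D_def orthogonal_def inner_commute)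
    qed
    then have "orthogonal h h" using orthogonal_to_span[of h B h] B(5) by auto
    then show "h = 0" by (simp add: orthogonal_self)
  qed
  then obtain E where E: "linear E" "E \<circ> D x = id"
    using linear_injective_left_inverse lin bounded_linear.linear by blast
  then have blE: "bounded_linear E" by (simp add: linear_conv_bounded_linear)
  have "Blinfun E o\<^sub>L Blinfun (D x) = id_blinfun"
    using E(2) by (intro blinfun_eqI)
      (simp add: bounded_linear_Blinfun_apply[OF lin] bounded_linear_Blinfun_apply[OF blE] fun_eq_iff)
  note inverse = inverse_function_theorem[OF open_UNIV _ contD UNIV_I this, of \<Psi>,
      unfolded bounded_linear_Blinfun_apply[OF lin]]
  obtain U' V g g' where U': "open U'" "x \<in> U'" and V: "open V" "\<Psi> x \<in> V"
    and hom: "homeomorphism U' V \<Psi> g"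
    and g: "\<And>y. y \<in> V \<Longrightarrow> (g has_derivative g' y) (at y)"
    and g': "\<And>y. y \<in> V \<Longrightarrow> g' y = inv (D (g y))" "\<And>y. y \<in> V \<Longrightarrow> bij (D (g y))"
    by (rule inverse) (rule der, blast)
  \<comment> \<open>A ball is convex, so the segment from \<open>\<Psi> x\<close> to
    \<open>\<Psi> y\<close> stays in the range of the chart.\<close>
  obtain r where r: "r > 0" "ball (\<Psi> x) r \<subseteq> V" by (rule openE[OF V])
  define U where "U = U' \<inter> \<Psi> -` ball (\<Psi> x) r"
  have "continuous_on UNIV \<Psi>"
    using der by (rule has_derivative_continuous_on)
  then have "open (\<Psi> -` ball (\<Psi> x) r)" by (simp add: continuous_on_open_vimage)
  then have "open U" unfolding U_def using U' by blast
  moreover have "x \<in> U" using U' r by (simp add: U_def)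
  moreover have "f k y = f k x" if y: "y \<in> U" "\<And>j. j \<in> S \<Longrightarrow> f j y = f j x" and k: "k \<in> K" for y k
  proof -
    define h where "h = \<Psi> y - \<Psi> x"
    have hS: "h \<bullet> \<sigma> (G j x) = 0" if "j \<in> S" for j
      using \<Theta>_S[OF that] y(2)[OF that] by (simp add: h_def \<Psi>_def inner_diff_left)
    define \<gamma> where "\<gamma> t = g (\<Psi> x + t *\<^sub>R h)" for t
    have "(f k \<circ> \<gamma> has_derivative (\<lambda>s. 0)) (at t within {0..1})" if t: "t \<in> {0..1}" for t
    proof -
      have "\<Psi> x \<in> ball (\<Psi> x) r" "\<Psi> y \<in> ball (\<Psi> x) r" using r y(1) by (auto simp: U_def)
      then have "(1 - t) *\<^sub>R \<Psi> x + t *\<^sub>R \<Psi> y \<in> ball (\<Psi> x) r"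
        using t by (intro convexD_alt[OF convex_ball]) simp_all
      then have inV: "\<Psi> x + t *\<^sub>R h \<in> V" using r(2) by (auto simp: h_def algebra_simps)
      let ?z = "\<gamma> t"
      have bij: "bij (D ?z)" using g'(2)[OF inV] by (simp add: \<gamma>_def)
      define u where "u = g' (\<Psi> x + t *\<^sub>R h) h"
      have "D ?z u = h"
        using g'(1)[OF inV] bij by (simp add: u_def \<gamma>_def bij_is_surj surj_f_inv_f)
      then have uS: "G j ?z \<bullet> u = 0" if "j \<in> S" for j
        using \<Theta>_S[OF that, of "\<lambda>k. G k ?z \<bullet> u" u] hS[OF that] by (simp add: D_def)
      \<comment> \<open>Surjectivity of the derivative keeps the gradients of \<open>S\<close>
        independent at \<open>?z\<close>, not only at \<open>x\<close>.\<close>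
      have "\<exists>w. \<forall>j\<in>S. G j ?z \<bullet> w = c j" for c
      proof -
        obtain w where "\<Theta> c 0 = D ?z w" using bij by (metis bij_pointE)
        then show ?thesis using \<Theta>_S by (metis D_def)
      qed
      then have ind: "inj_on (\<lambda>j. G j ?z) S" "independent ((\<lambda>j. G j ?z) ` S)"
        by (rule independent_familyI)+
      have "(\<lambda>k. G k ?z) ` K \<subseteq> span ((\<lambda>j. G j ?z) ` S)"
        using card_ge_dim_independent[OF image_mono[OF K(2)] ind(2)] rank[of ?z] card_image[OF ind(1)]
        by simp
      then have "G k ?z \<in> span ((\<lambda>j. G j ?z) ` S)" using k by blast
      moreover have "orthogonal u y" if "y \<in> (\<lambda>j. G j ?z) ` S" for y
        using uS that by (auto simp: orthogonal_def inner_commute)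
      ultimately have "orthogonal u (G k ?z)" by (rule orthogonal_to_span)
      then have zero: "G k ?z \<bullet> u = 0" by (simp add: orthogonal_def inner_commute)
      have "((\<lambda>t. \<Psi> x + t *\<^sub>R h) has_derivative (\<lambda>s. s *\<^sub>R h)) (at t)"
        by (auto intro!: derivative_eq_intros)
      then have "(\<gamma> has_derivative (\<lambda>s. g' (\<Psi> x + t *\<^sub>R h) (s *\<^sub>R h))) (at t)"
        unfolding \<gamma>_def using g[OF inV] by (rule has_derivative_compose)
      then have "(f k \<circ> \<gamma> has_derivative (\<lambda>s. G k ?z \<bullet> g' (\<Psi> x + t *\<^sub>R h) (s *\<^sub>R h))) (at t)"
        unfolding comp_def using deriv[OF k] by (rule has_derivative_compose)
      moreover have "g' (\<Psi> x + t *\<^sub>R h) (s *\<^sub>R h) = s *\<^sub>R u" for s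
        using has_derivative_linear[OF g[OF inV]] by (simp add: u_def linear_scale)
      ultimately have "(f k \<circ> \<gamma> has_derivative (\<lambda>s. 0)) (at t)" using zero by simp
      then show ?thesis by (rule has_derivative_at_withinI)
    qed
    then obtain c where c: "\<And>t. t \<in> {0..1} \<Longrightarrow> (f k \<circ> \<gamma>) t = c"
      using has_derivative_zero_constant[of "{0..1::real}" "f k \<circ> \<gamma>"] by auto
    have "\<gamma> 0 = x" "\<gamma> 1 = y"
      using hom U' y(1) by (auto simp: \<gamma>_def h_def U_def homeomorphism_def)
    then show ?thesis using c[of 0] c[of 1] by simp
  qed
  moreover have "\<exists>y\<in>U. y \<noteq> x \<and> (\<forall>j\<in>S. f j y = f j x)" if "card S < DIM('a)"
  proof -
    have "card B = DIM('a)" using \<sigma> bij_betw_same_card by blast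
    moreover have "card B0 = card S" unfolding B0_def by (rule card_image[OF indep(1)])
    ultimately have "B \<noteq> B0" using that by auto
    then obtain b where b: "b \<in> C" using B(1) by (auto simp: C_def)
    then have bB: "b \<in> B" by (simp add: C_def)
    then have nb: "norm (\<sigma> b) = 1" using \<sigma> by (metis bij_betwE norm_Basis)
    define v where "v = \<Psi> x + (r / 2) *\<^sub>R \<sigma> b"
    have vV: "v \<in> ball (\<Psi> x) r" using r(1) nb by (simp add: v_def dist_norm)
    then have gv: "g v \<in> U'" "\<Psi> (g v) = v"
      using hom r(2) by (auto simp: homeomorphism_def)
    have "g v \<in> U" using gv vV by (simp add: U_def)
    moreover have "g v \<noteq> x"
      using gv(2) r(1) nb by (auto simp: v_def)
    moreover have "f j (g v) = f j x" if j: "j \<in> S" for j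
    proof -
      have "G j x \<noteq> b" using b j by (auto simp: C_def B0_def)
      then have "v \<bullet> \<sigma> (G j x) = \<Psi> x \<bullet> \<sigma> (G j x)"
        using inner_\<sigma>[OF bB GB[OF j]] by (simp add: v_def inner_add_left)
      then show ?thesis using \<Theta>_S[OF j] gv(2) by (metis \<Psi>_def)
    qed
    ultimately show ?thesis by blast
  qed
  ultimately show thesis by (rule that)
qed

section \<open>A homotopy argument for a second intersection point\<close>

lemma homotopic_with_canonI:
  fixes S :: "'a::topological_space set" and T :: "'b::topological_space set"
  assumes "continuous_on ({0..1::real} \<times> S) (\<lambda>z. H (fst z) (snd z))"
    and "\<And>t x. t \<in> {0..1} \<Longrightarrow> x \<in> S \<Longrightarrow> H t x \<in> T"
  shows "homotopic_with_canon (\<lambda>_. True) S T (H 0) (H 1)"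
  unfolding homotopic_with_def
  using assms by (intro exI[of _ "\<lambda>z. H (fst z) (snd z)"]) auto

text \<open>On a small sphere around \<open>p\<close> the map looks like its invertible derivative
  \<open>A\<close>. With no other zero in the way, the sphere expands to radius \<open>R\<close>.
  There the shift by \<open>T\<close> times \<open>e\<close> creates no zero, and the shifted map
  has none in the ball, so the sphere can be shrunk to a point. Undoing \<open>A\<close> contracts
  the unit sphere.\<close>

lemma isolated_zero_essential:
  fixes \<Phi> :: "'a::euclidean_space \<Rightarrow> 'a"
  assumes cont: "continuous_on UNIV \<Phi>"
    and der: "(\<Phi> has_derivative A) (at p)" and inj: "inj A"
    and zero: "\<Phi> p = 0" and unique: "\<And>y. \<Phi> y = 0 \<Longrightarrow> y = p"
    and R: "R > 0"
    and sphere: "\<And>y t. t \<ge> 0 \<Longrightarrow> norm (y - p) = R \<Longrightarrow> \<Phi> y + t *\<^sub>R e \<noteq> 0"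
    and ball: "T \<ge> 0" "\<And>y. norm (y - p) \<le> R \<Longrightarrow> \<Phi> y + T *\<^sub>R e \<noteq> 0"
  shows False
proof -
  let ?S = "sphere (0::'a) 1" and ?N = "UNIV - {0::'a}"
  have contc: "continuous_on X (\<lambda>z. \<Phi> (u z))" if "continuous_on X u" for X and u :: "'c::topological_space \<Rightarrow> 'a"
    using continuous_on_compose2[OF cont that] by simp
  have lin: "linear A" using has_derivative_linear[OF der] .
  obtain B where B: "B > 0" "\<And>v. B * norm v \<le> norm (A v)"
    using linear_inj_bounded_below_pos[OF lin inj] by blast
  \<comment> \<open>The factor 1/2 keeps the linearisation error strictly below the lower bound for
    \<open>A\<close>, so that the segments between the two maps miss 0.\<close>
  obtain d where d: "d > 0" "\<And>y. norm (y - p) < d \<Longrightarrow>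
      norm (\<Phi> y - \<Phi> p - A (y - p)) \<le> (B / 2) * norm (y - p)"
    using der B(1) unfolding has_derivative_at_alt by (metis half_gt_zero)
  define \<delta> where "\<delta> = d / 2"
  have \<delta>: "\<delta> > 0" "\<delta> < d" using d(1) by (auto simp: \<delta>_def)
  have "homotopic_with_canon (\<lambda>_. True) ?S ?N (\<lambda>u. A (\<delta> *\<^sub>R u)) (\<lambda>u. \<Phi> (p + \<delta> *\<^sub>R u))"
  proof (rule homotopic_with_linear)
    show "continuous_on ?S (\<lambda>u. A (\<delta> *\<^sub>R u))"
      by (intro bounded_linear.continuous_on[OF has_derivative_bounded_linear[OF der]] continuous_intros)
    show "continuous_on ?S (\<lambda>u. \<Phi> (p + \<delta> *\<^sub>R u))"
      by (intro contc continuous_intros)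
    fix u :: 'a assume "u \<in> ?S"
    then have u: "norm (\<delta> *\<^sub>R u) = \<delta>" using \<delta> by simp
    have "norm (\<Phi> (p + \<delta> *\<^sub>R u) - A (\<delta> *\<^sub>R u)) \<le> (B / 2) * \<delta>"
      using d(2)[of "p + \<delta> *\<^sub>R u"] u \<delta>(2) zero by simp
    moreover have "B * \<delta> \<le> norm (A (\<delta> *\<^sub>R u))" using B(2)[of "\<delta> *\<^sub>R u"] u by simp
    moreover have "B * \<delta> > 0" using B(1) \<delta>(1) by simp
    ultimately have less: "norm (\<Phi> (p + \<delta> *\<^sub>R u) - A (\<delta> *\<^sub>R u)) < norm (A (\<delta> *\<^sub>R u))" by linarith
    have "0 \<notin> closed_segment (A (\<delta> *\<^sub>R u)) (\<Phi> (p + \<delta> *\<^sub>R u))"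
    proof
      assume "0 \<in> closed_segment (A (\<delta> *\<^sub>R u)) (\<Phi> (p + \<delta> *\<^sub>R u))"
      then obtain s where s: "0 \<le> s" "s \<le> 1" "0 = (1 - s) *\<^sub>R A (\<delta> *\<^sub>R u) + s *\<^sub>R \<Phi> (p + \<delta> *\<^sub>R u)"
        by (auto simp: closed_segment_def)
      then have "A (\<delta> *\<^sub>R u) = - s *\<^sub>R (\<Phi> (p + \<delta> *\<^sub>R u) - A (\<delta> *\<^sub>R u))"
        by (simp add: algebra_simps)
      then have "norm (A (\<delta> *\<^sub>R u)) = s * norm (\<Phi> (p + \<delta> *\<^sub>R u) - A (\<delta> *\<^sub>R u))"
        using s(1) by (metis abs_minus_cancel abs_of_nonneg norm_scaleR)
      also have "\<dots> \<le> norm (\<Phi> (p + \<delta> *\<^sub>R u) - A (\<delta> *\<^sub>R u))"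
        using s(1,2) mult_left_le_one_le norm_ge_zero by blast
      finally show False using less by simp
    qed
    then show "closed_segment (A (\<delta> *\<^sub>R u)) (\<Phi> (p + \<delta> *\<^sub>R u)) \<subseteq> ?N" by blast
  qed
  moreover have "homotopic_with_canon (\<lambda>_. True) ?S ?N (\<lambda>u. \<Phi> (p + \<delta> *\<^sub>R u)) (\<lambda>u. \<Phi> (p + R *\<^sub>R u))"
  proof -
    have "\<Phi> (p + ((1 - t) * \<delta> + t * R) *\<^sub>R u) \<noteq> 0" if "t \<in> {0..1}" "u \<in> ?S" for t and u :: 'a
    proof
      assume "\<Phi> (p + ((1 - t) * \<delta> + t * R) *\<^sub>R u) = 0"
      then have "((1 - t) * \<delta> + t * R) *\<^sub>R u = 0" using unique by fastforce
      moreover have "(1 - t) * \<delta> + t * R > 0"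
        using that R \<delta>(1) by (cases "t = 1") (auto intro: add_pos_nonneg)
      ultimately show False using that by auto
    qed
    moreover have "continuous_on ({0..1} \<times> ?S) (\<lambda>z. \<Phi> (p + ((1 - fst z) * \<delta> + fst z * R) *\<^sub>R snd z))"
      by (intro contc continuous_intros)
    ultimately show ?thesis
      using homotopic_with_canonI[of ?S "\<lambda>t u. \<Phi> (p + ((1 - t) * \<delta> + t * R) *\<^sub>R u)" ?N] by simp
  qed
  moreover have "homotopic_with_canon (\<lambda>_. True) ?S ?N (\<lambda>u. \<Phi> (p + R *\<^sub>R u)) (\<lambda>u. \<Phi> (p + R *\<^sub>R u) + T *\<^sub>R e)"
  proof -
    have "\<Phi> (p + R *\<^sub>R u) + (t * T) *\<^sub>R e \<noteq> 0" if "t \<in> {0..1}" "u \<in> ?S" for t and u :: 'a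
      using sphere[of "t * T" "p + R *\<^sub>R u"] that ball(1) R by simp
    moreover have "continuous_on ({0..1} \<times> ?S) (\<lambda>z. \<Phi> (p + R *\<^sub>R snd z) + (fst z * T) *\<^sub>R e)"
      by (intro contc continuous_intros)
    ultimately show ?thesis
      using homotopic_with_canonI[of ?S "\<lambda>t u. \<Phi> (p + R *\<^sub>R u) + (t * T) *\<^sub>R e" ?N] by simp
  qed
  moreover have "homotopic_with_canon (\<lambda>_. True) ?S ?N (\<lambda>u. \<Phi> (p + R *\<^sub>R u) + T *\<^sub>R e) (\<lambda>u. \<Phi> p + T *\<^sub>R e)"
  proof -
    have "\<Phi> (p + ((1 - t) * R) *\<^sub>R u) + T *\<^sub>R e \<noteq> 0" if "t \<in> {0..1}" "u \<in> ?S" for t and u :: 'a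
      using ball(2)[of "p + ((1 - t) * R) *\<^sub>R u"] that R
      by (simp add: mult_left_le_one_le)
    moreover have "continuous_on ({0..1} \<times> ?S) (\<lambda>z. \<Phi> (p + ((1 - fst z) * R) *\<^sub>R snd z) + T *\<^sub>R e)"
      by (intro contc continuous_intros)
    ultimately show ?thesis
      using homotopic_with_canonI[of ?S "\<lambda>t u. \<Phi> (p + ((1 - t) * R) *\<^sub>R u) + T *\<^sub>R e" ?N] by simp
  qed
  ultimately have hom: "homotopic_with_canon (\<lambda>_. True) ?S ?N (\<lambda>u. A (\<delta> *\<^sub>R u)) (\<lambda>u. \<Phi> p + T *\<^sub>R e)"
    by (blast intro: homotopic_with_trans)
  obtain A' where A': "linear A'" "\<And>v. A' (A v) = v" "\<And>w. A (A' w) = w"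
    using linear_injective_isomorphism[OF lin inj] by blast
  have A'0: "A' w \<noteq> 0" if "w \<noteq> 0" for w
    using that A'(3)[of w] linear_0[OF lin] by auto
  \<comment> \<open>Inverting \<open>A\<close> and normalising turns \<open>A (\<delta> u)\<close>
    back into the unit vector \<open>u\<close>.\<close>
  define n where "n w = A' w /\<^sub>R norm (A' w)" for w
  have "continuous_on ?N n"
    unfolding n_def using A'0 linear_continuous_on[OF A'(1)[unfolded linear_conv_bounded_linear]]
    by (intro continuous_intros) auto
  moreover have "n \<in> ?N \<rightarrow> ?S" using A'0 by (auto simp: n_def)
  ultimately have "homotopic_with_canon (\<lambda>_. True) ?S ?S (n \<circ> (\<lambda>u. A (\<delta> *\<^sub>R u))) (n \<circ> (\<lambda>u. \<Phi> p + T *\<^sub>R e))"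
    using homotopic_with_compose_continuous_left[OF hom] by blast
  moreover have "(n \<circ> (\<lambda>u. A (\<delta> *\<^sub>R u))) u = u" if "u \<in> ?S" for u
  proof -
    show ?thesis using that \<delta>(1) by (simp add: n_def A'(2))
  qed
  ultimately have "homotopic_with_canon (\<lambda>_. True) ?S ?S id (\<lambda>u. n (\<Phi> p + T *\<^sub>R e))"
    by (elim homotopic_with_eq) auto
  then have "contractible ?S" unfolding contractible_def by blast
  then show False by (simp add: contractible_sphere)
qed

lemma level_set_meets_twice:
  fixes f :: "'k \<Rightarrow> 'a::euclidean_space \<Rightarrow> real" and G :: "'k \<Rightarrow> 'a \<Rightarrow> 'a" and g :: "'a \<Rightarrow> real"
  assumes K: "finite K" "S \<subseteq> K"
    and deriv: "\<And>k y. k \<in> K \<Longrightarrow> (f k has_derivative (\<lambda>h. G k y \<bullet> h)) (at y)"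
    and cont: "\<And>k. k \<in> K \<Longrightarrow> continuous_on UNIV (G k)"
    and rank: "\<And>y. dim ((\<lambda>k. G k y) ` K) \<le> card S"
    and card: "card S + 1 = DIM('a)"
    and indep: "\<And>x. (\<And>k. k \<in> K \<Longrightarrow> f k x = f k p) \<Longrightarrow>
      inj_on (\<lambda>k. G k x) S \<and> independent ((\<lambda>k. G k x) ` S)"
    and bounded: "bounded {x. \<forall>k\<in>K. f k x = f k p}"
    and contg: "continuous_on UNIV g" and derg: "(g has_derivative (\<lambda>h. \<gamma> \<bullet> h)) (at p)"
    and \<gamma>: "\<gamma> \<notin> span ((\<lambda>k. G k p) ` S)"
  shows "\<exists>x. x \<noteq> p \<and> (\<forall>k\<in>K. f k x = f k p) \<and> g x = g p"
proof (rule ccontr)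
  define F where "F = {x. \<forall>k\<in>K. f k x = f k p}"
  assume "\<not> ?thesis"
  then have unique: "\<And>x. x \<in> F \<Longrightarrow> g x = g p \<Longrightarrow> x = p" by (auto simp: F_def)
  define Z where "Z = {x. \<forall>k\<in>S. f k x = f k p}"
  have pF: "p \<in> F" by (simp add: F_def)
  have contf: "continuous_on UNIV (f k)" if "k \<in> K" for k
    using deriv[OF that] by (rule has_derivative_continuous_on)
  have closed: "closed {x. \<forall>k\<in>A. f k x = f k p}" if "A \<subseteq> K" for A
  proof -
    have "{x. \<forall>k\<in>A. f k x = f k p} = (\<Inter>k\<in>A. {x. f k x = f k p})" by auto
    also have "closed \<dots>"
      using that contf by (intro closed_INT ballI closed_Collect_eq) (auto intro: continuous_intros)
    finally show ?thesis .
  qed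
  \<comment> \<open>By constant rank the equations of \<open>S\<close> imply those of
    \<open>K\<close> near each point of \<open>F\<close>. So \<open>F\<close> is open in
    \<open>Z\<close>, which makes \<open>Z - F\<close> closed.\<close>
  have "\<exists>U. open U \<and> x \<in> U \<and> U \<inter> Z \<subseteq> F" if x: "x \<in> F" for x
  proof -
    have x_eq: "f k x = f k p" if "k \<in> K" for k using x that by (simp add: F_def)
    then have ind: "inj_on (\<lambda>k. G k x) S" "independent ((\<lambda>k. G k x) ` S)" using indep by blast+
    obtain U where U: "open U" "x \<in> U"
      "\<And>y k. y \<in> U \<Longrightarrow> (\<And>j. j \<in> S \<Longrightarrow> f j y = f j x) \<Longrightarrow> k \<in> K \<Longrightarrow> f k y = f k x"
      by (rule constant_rank_level_set[OF K deriv cont ind rank]) blast+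
    have "y \<in> F" if "y \<in> U" "y \<in> Z" for y
    proof -
      have "f j y = f j x" if "j \<in> S" for j
        using \<open>y \<in> Z\<close> that x_eq[of j] K(2) by (auto simp: Z_def)
      then have "f k y = f k x" if "k \<in> K" for k by (rule U(3)[OF \<open>y \<in> U\<close> _ that])
      then show ?thesis using x_eq by (simp add: F_def)
    qed
    then show ?thesis using U by blast
  qed
  then obtain U where U: "\<And>x. x \<in> F \<Longrightarrow> open (U x) \<and> x \<in> U x \<and> U x \<inter> Z \<subseteq> F" by metis
  have "Z - F = Z - (\<Union>x\<in>F. U x)" using U by blast
  moreover have "closed \<dots>"
    using U closed[OF K(2)] by (intro closed_Diff open_UN) (auto simp: Z_def)
  ultimately have closed_rest: "closed (Z - F)" by simp
  obtain \<delta> where \<delta>: "\<delta> > 0" "cball p \<delta> \<subseteq> U p" using U[OF pF] open_contains_cball by metis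
  have "closed (F \<union> cball p \<delta>)" using closed[of K] by (auto simp: F_def)
  moreover have "(F \<union> cball p \<delta>) \<inter> (Z - F) = {}" using \<delta>(2) U[OF pF] by blast
  \<comment> \<open>Vanishing on a ball around \<open>p\<close> besides \<open>F\<close> preserves
    the derivative of \<open>g\<close> at \<open>p\<close>.\<close>
  ultimately obtain \<eta> :: "'a \<Rightarrow> real" where \<eta>: "continuous_on UNIV \<eta>"
    "\<And>x. x \<in> F \<union> cball p \<delta> \<Longrightarrow> \<eta> x = 0" "\<And>x. x \<in> Z - F \<Longrightarrow> \<eta> x = 1"
    using Urysohn[OF _ closed_rest, of "F \<union> cball p \<delta>" 0 "1::real"] by metis
  \<comment> \<open>The value is 1 on \<open>Z - F\<close>, so no zero arises there, not even after
    a non-negative shift; on \<open>F\<close> the original equation for \<open>g\<close>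
    remains.\<close>
  define h where "h y = (1 - \<eta> y) * (g y - g p) + \<eta> y" for y
  have conth: "continuous_on UNIV h"
    unfolding h_def by (intro continuous_intros \<eta> contg)
  have "((\<lambda>y. g y - g p) has_derivative (\<lambda>v. \<gamma> \<bullet> v)) (at p)"
    using has_derivative_diff[OF derg has_derivative_const[of "g p"]] by simp
  then have derh: "(h has_derivative (\<lambda>v. \<gamma> \<bullet> v)) (at p)"
    by (rule has_derivative_transform_within_open[of _ _ _ _ "ball p \<delta>"])
       (use \<delta>(1) \<eta>(2) in \<open>auto simp: h_def\<close>)
  define B where "B = insert \<gamma> ((\<lambda>k. G k p) ` S)"
  have ind_p: "inj_on (\<lambda>k. G k p) S" "independent ((\<lambda>k. G k p) ` S)" using indep[of p] by auto
  have finS: "finite S" using K finite_subset by blast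
  have "independent B" unfolding B_def using ind_p(2) \<gamma> by (rule independent_insertI[rotated])
  moreover have cardB: "card B = DIM('a)"
  proof -
    have "\<gamma> \<notin> (\<lambda>k. G k p) ` S" using \<gamma> span_base[of \<gamma>] by metis
    then show ?thesis using card finS ind_p(1) by (simp add: B_def card_image)
  qed
  ultimately have spanB: "span B = UNIV"
    using card_eq_dim[of B UNIV] finS by (auto simp: B_def)
  obtain \<sigma> where \<sigma>: "bij_betw \<sigma> B (Basis :: 'a set)"
    using finite_same_card_bij[of B "Basis :: 'a set"] cardB finS finite_Basis by (auto simp: B_def)
  have inner_\<sigma>: "\<sigma> b \<bullet> \<sigma> b' = (if b = b' then 1 else 0)" if "b \<in> B" "b' \<in> B" for b b'
  proof -
    have "\<sigma> b \<in> Basis" "\<sigma> b' \<in> Basis" "\<sigma> b = \<sigma> b' \<longleftrightarrow> b = b'"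
      using that \<sigma> by (auto simp: bij_betw_def inj_on_eq_iff)
    then show ?thesis by (simp add: inner_Basis)
  qed
  have ne: "G k p \<noteq> \<gamma>" if "k \<in> S" for k using that \<gamma> span_base[of "G k p" "(\<lambda>k. G k p) ` S"] by auto
  define \<Theta> where "\<Theta> a c = (\<Sum>k\<in>S. a k *\<^sub>R \<sigma> (G k p)) + c *\<^sub>R \<sigma> \<gamma>" for a and c :: real
  have \<Theta>_S: "\<Theta> a c \<bullet> \<sigma> (G k p) = a k" if k: "k \<in> S" for a c k
  proof -
    have "\<Theta> a c \<bullet> \<sigma> (G k p) = (\<Sum>j\<in>S. a j * (\<sigma> (G j p) \<bullet> \<sigma> (G k p))) + c * (\<sigma> \<gamma> \<bullet> \<sigma> (G k p))"
      by (simp add: \<Theta>_def inner_add_left inner_sum_left)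
    also have "\<dots> = (\<Sum>j\<in>S. if j = k then a j else 0)"
    proof -
      have "\<sigma> \<gamma> \<bullet> \<sigma> (G k p) = 0" using inner_\<sigma>[of \<gamma> "G k p"] k ne[OF k] by (auto simp: B_def)
      moreover have "\<sigma> (G j p) \<bullet> \<sigma> (G k p) = (if j = k then 1 else 0)" if "j \<in> S" for j
        using inner_\<sigma>[of "G j p" "G k p"] k that inj_onD[OF ind_p(1) _ that k] by (auto simp: B_def)
      ultimately show ?thesis by (auto intro: sum.cong)
    qed
    finally show ?thesis using k finS by simp
  qed
  have \<Theta>_\<gamma>: "\<Theta> a c \<bullet> \<sigma> \<gamma> = c" for a c
  proof -
    have "\<sigma> (G k p) \<bullet> \<sigma> \<gamma> = 0" if "k \<in> S" for k
      using inner_\<sigma>[of "G k p" \<gamma>] that ne[OF that] by (auto simp: B_def)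
    moreover have "\<sigma> \<gamma> \<bullet> \<sigma> \<gamma> = 1" using inner_\<sigma>[of \<gamma> \<gamma>] by (simp add: B_def)
    ultimately show ?thesis by (simp add: \<Theta>_def inner_add_left inner_sum_left)
  qed
  define \<Phi> where "\<Phi> y = \<Theta> (\<lambda>k. f k y - f k p) (h y)" for y
  define A where "A v = \<Theta> (\<lambda>k. G k p \<bullet> v) (\<gamma> \<bullet> v)" for v
  have cont\<Phi>: "continuous_on UNIV \<Phi>"
    unfolding \<Phi>_def \<Theta>_def using K(2) by (intro continuous_intros contf conth) auto
  have der\<Phi>: "(\<Phi> has_derivative A) (at p)"
    unfolding \<Phi>_def A_def \<Theta>_def using K(2) by (auto intro!: derivative_eq_intros deriv derh)
  have "inj A"
  proof (rule linear_injective_0[THEN iffD2, rule_format])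
    show "linear A" using der\<Phi> by (rule has_derivative_linear)
    fix v assume v: "A v = 0"
    have "orthogonal v b" if "b \<in> B" for b
      using that v \<Theta>_\<gamma>[of "\<lambda>k. G k p \<bullet> v" "\<gamma> \<bullet> v"] \<Theta>_S[of _ "\<lambda>k. G k p \<bullet> v" "\<gamma> \<bullet> v"]
      by (auto simp: B_def A_def orthogonal_def inner_commute)
    then have "orthogonal v v" using orthogonal_to_span[of v B v] spanB by auto
    then show "v = 0" by (simp add: orthogonal_self)
  qed
  have zero: "y \<in> Z \<and> h y + t = 0" if "\<Phi> y + t *\<^sub>R \<sigma> \<gamma> = 0" for y t
  proof -
    have *: "\<Phi> y + t *\<^sub>R \<sigma> \<gamma> = \<Theta> (\<lambda>k. f k y - f k p) (h y + t)"
      by (simp add: \<Phi>_def \<Theta>_def scaleR_left_distrib add.assoc)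
    have "f k y = f k p" if "k \<in> S" for k
      using \<Theta>_S[OF that, of "\<lambda>k. f k y - f k p" "h y + t"] \<open>\<Phi> y + t *\<^sub>R \<sigma> \<gamma> = 0\<close> * by simp
    moreover have "h y + t = 0"
      using \<Theta>_\<gamma>[of "\<lambda>k. f k y - f k p" "h y + t"] that * by simp
    ultimately show ?thesis by (simp add: Z_def)
  qed
  have h_rest: "h y = 1" if "y \<in> Z" "y \<notin> F" for y using \<eta>(3) that by (simp add: h_def)
  have h_F: "h y = g y - g p" if "y \<in> F" for y using \<eta>(2) that by (simp add: h_def)
  \<comment> \<open>The sphere of radius \<open>R\<close> misses \<open>F\<close>, so solutions of
    \<open>S\<close> on it lie in \<open>Z - F\<close>, where \<open>h\<close> is 1.\<close>
  obtain R where R: "R > 0" "F \<subseteq> ball p R"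
    using bounded_subset_ballD[OF bounded, of p] unfolding F_def by blast
  have "compact (h ` cball p R)"
    using conth by (intro compact_continuous_image) (auto intro: continuous_on_subset)
  then obtain M where M: "\<And>y. y \<in> cball p R \<Longrightarrow> \<bar>h y\<bar> \<le> M"
    using compact_imp_bounded bounded_iff by (metis image_eqI real_norm_def)
  show False
  proof (rule isolated_zero_essential[OF cont\<Phi> der\<Phi> \<open>inj A\<close>])
    show "\<Phi> p = 0" using h_F[OF pF] by (simp add: \<Phi>_def \<Theta>_def)
    show "y = p" if "\<Phi> y = 0" for y
      using zero[of y 0] that h_rest[of y] h_F[of y] unique[of y] by fastforce
    show "R > 0" by (rule R(1))
    show "\<Phi> y + t *\<^sub>R \<sigma> \<gamma> \<noteq> 0" if "t \<ge> 0" "norm (y - p) = R" for y t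
    proof
      assume "\<Phi> y + t *\<^sub>R \<sigma> \<gamma> = 0"
      then have "y \<in> Z" "h y + t = 0" using zero by auto
      moreover have "y \<notin> F" using R(2) that(2) by (auto simp: dist_norm norm_minus_commute)
      ultimately show False using h_rest that(1) by fastforce
    qed
    \<comment> \<open>A shift larger than the bound for \<open>h\<close> on the ball removes all
      zeros; the absolute value makes its sign evident.\<close>
    show "\<bar>M\<bar> + 1 \<ge> 0" by simp
    show "\<Phi> y + (\<bar>M\<bar> + 1) *\<^sub>R \<sigma> \<gamma> \<noteq> 0" if "norm (y - p) \<le> R" for y
    proof
      assume "\<Phi> y + (\<bar>M\<bar> + 1) *\<^sub>R \<sigma> \<gamma> = 0"
      then have "h y + (\<bar>M\<bar> + 1) = 0" using zero by blast
      moreover have "\<bar>h y\<bar> \<le> M" using M[of y] that by (simp add: dist_norm norm_minus_commute)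
      ultimately show False by linarith
    qed
  qed
qed

section \<open>Edge, loop and pinning constraints\<close>

text \<open>Frameworks become points of a Euclidean space whose coordinates are the column indices
  of the rigidity matrix, so that rows of the matrix are gradients in this space.
  \<open>configuration\<close> is the inverse translation.\<close>

definition position :: "real^('v::finite \<times> 'd::finite) \<Rightarrow> 'v \<Rightarrow> real^'d" where
  "position x v = (\<chi> i. x $ (v, i))"

definition configuration :: "('v::finite \<Rightarrow> real^'d::finite) \<Rightarrow> real^('v \<times> 'd)" where
  "configuration p = (\<chi> c. p (fst c) $ snd c)"

lemma position_configuration [simp]: "position (configuration p) = p"
  by (auto simp: position_def configuration_def vec_eq_iff)

lemma configuration_eq_iff: "configuration p = x \<longleftrightarrow> p = position x"
  by (auto simp: position_def configuration_def vec_eq_iff fun_eq_iff)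

lemma bounded_linear_position: "bounded_linear (\<lambda>x. position x v)"
  unfolding position_def linear_conv_bounded_linear[symmetric]
  by (rule linearI) (auto simp: vec_eq_iff)

lemma inner_position: "x \<bullet> y = (\<Sum>v\<in>UNIV. position x v \<bullet> position y v)"
  by (simp add: position_def inner_vec_def sum.cartesian_product)

lemma position_rigidity_edge:
  assumes "{u, v} \<in> edges G" "u \<noteq> v"
  shows "position (rigidity_matrix G p q $ Inl {u, v}) w =
    (if w = u then p u - p v else if w = v then p v - p u else 0)"
  using assms by (simp add: position_def vec_eq_iff rigidity_matrix_edge)

lemma inner_rigidity_edge:
  assumes "{u, v} \<in> edges G" "u \<noteq> v"
  shows "rigidity_matrix G p q $ Inl {u, v} \<bullet> h = (p u - p v) \<bullet> (position h u - position h v)"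
proof -
  have "rigidity_matrix G p q $ Inl {u, v} \<bullet> h =
      (\<Sum>w\<in>UNIV. (if w = u then (p u - p v) \<bullet> position h u else 0) +
        (if w = v then (p v - p u) \<bullet> position h v else 0))"
    unfolding inner_position position_rigidity_edge[OF assms]
    using assms(2) by (intro sum.cong) auto
  also have "\<dots> = (p u - p v) \<bullet> position h u + (p v - p u) \<bullet> position h v"
    by (simp add: sum.distrib)
  finally show ?thesis by (simp add: inner_diff_left inner_diff_right)
qed

lemma position_rigidity_loop:
  assumes "l \<in> loops G"
  shows "position (rigidity_matrix G p q $ Inr l) w = (if w = anchor G l then q l else 0)"
  using assms by (simp add: position_def vec_eq_iff rigidity_matrix_def)

lemma inner_rigidity_loop:
  assumes "l \<in> loops G"
  shows "rigidity_matrix G p q $ Inr l \<bullet> h = q l \<bullet> position h (anchor G l)"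
proof -
  have "rigidity_matrix G p q $ Inr l \<bullet> h =
      (\<Sum>w\<in>UNIV. if w = anchor G l then q l \<bullet> position h (anchor G l) else 0)"
    unfolding inner_position position_rigidity_loop[OF assms] by (intro sum.cong) auto
  then show ?thesis by simp
qed

text \<open>
  Besides the edges and the loops, every coordinate of a vertex outside the graph is constrained;
  an infinitesimally rigid framework then has constraint gradients spanning the whole space.
\<close>

type_synonym ('v, 'l, 'd) constraint = "('v set + 'l) + ('v \<times> 'd)"

definition constraints :: "('v, 'l) lgraph \<Rightarrow> ('v, 'l, 'd) constraint set" where
  "constraints G = Inl ` (Inl ` edges G \<union> Inr ` loops G) \<union> Inr ` ((- verts G) \<times> UNIV)"

definition constraint_grad ::
    "('v::finite, 'l::finite) lgraph \<Rightarrow> ('l \<Rightarrow> real^'d::finite) \<Rightarrow> ('v, 'l, 'd) constraint \<Rightarrow>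
      real^('v \<times> 'd) \<Rightarrow> real^('v \<times> 'd)" where
  "constraint_grad G q k x =
    (case k of Inl r \<Rightarrow> rigidity_matrix G (position x) q $ r | Inr c \<Rightarrow> axis c 1)"

text \<open>The factor \<open>1/2\<close> makes the gradient of the quadratic edge constraints equal to their row.\<close>

definition constraint_fun ::
    "('v::finite, 'l::finite) lgraph \<Rightarrow> ('l \<Rightarrow> real^'d::finite) \<Rightarrow> ('v, 'l, 'd) constraint \<Rightarrow>
      real^('v \<times> 'd) \<Rightarrow> real" where
  "constraint_fun G q k x =
    (case k of Inl (Inl e) \<Rightarrow> 1/2 | _ \<Rightarrow> 1) * (constraint_grad G q k x \<bullet> x)"

lemma constraint_fun_edge:
  assumes "{u, v} \<in> edges G" "u \<noteq> v"
  shows "constraint_fun G q (Inl (Inl {u, v})) x = 1/2 * (norm (position x u - position x v))\<^sup>2"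
  using assms by (simp add: constraint_fun_def constraint_grad_def inner_rigidity_edge power2_norm_eq_inner)

lemma constraint_fun_loop:
  assumes "l \<in> loops G"
  shows "constraint_fun G q (Inl (Inr l)) x = q l \<bullet> position x (anchor G l)"
  using assms by (simp add: constraint_fun_def constraint_grad_def inner_rigidity_loop)

lemma constraint_fun_pin: "constraint_fun G q (Inr c) x = x $ c"
  by (simp add: constraint_fun_def constraint_grad_def inner_axis')

lemma edge_doubleton:
  assumes "looped_simple_graph G" "e \<in> edges G"
  obtains u v where "e = {u, v}" "u \<noteq> v" "u \<in> verts G" "v \<in> verts G"
  using assms by (auto simp: looped_simple_graph_def card_2_iff)

lemma constraints_cases:
  assumes "looped_simple_graph G" "k \<in> constraints G"
  obtains (edge) u v where "k = Inl (Inl {u, v})" "{u, v} \<in> edges G" "u \<noteq> v" "u \<in> verts G" "v \<in> verts G"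
  | (loop) l where "k = Inl (Inr l)" "l \<in> loops G" "anchor G l \<in> verts G"
  | (pin) c where "k = Inr c" "fst c \<notin> verts G"
proof -
  consider e where "k = Inl (Inl e)" "e \<in> edges G" | l where "k = Inl (Inr l)" "l \<in> loops G"
    | c where "k = Inr c" "fst c \<notin> verts G"
    using assms(2) by (auto simp: constraints_def)
  then show thesis
  proof cases
    case 1
    then show thesis using edge by (metis edge_doubleton[OF assms(1)])
  next
    case 2
    then show thesis using loop assms(1) by (auto simp: looped_simple_graph_def)
  qed (rule pin)
qed

lemma constraint_fun_has_derivative:
  assumes "looped_simple_graph G" "k \<in> constraints G"
  shows "(constraint_fun G q k has_derivative (\<lambda>h. constraint_grad G q k x \<bullet> h)) (at x)"
  using assms
proof (cases rule: constraints_cases)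
  case (edge u v)
  have "((\<lambda>x. position x u - position x v) has_derivative (\<lambda>h. position h u - position h v)) (at x)"
    by (intro has_derivative_diff bounded_linear_imp_has_derivative bounded_linear_position)
  from has_derivative_inner[OF this this]
  have "((\<lambda>x. 1/2 * (norm (position x u - position x v))\<^sup>2) has_derivative
      (\<lambda>h. (position x u - position x v) \<bullet> (position h u - position h v))) (at x)"
    unfolding power2_norm_eq_inner
    by (auto dest: has_derivative_mult_right[of _ _ _ "1/2"] simp: inner_commute)
  moreover have "constraint_fun G q k = (\<lambda>x. 1/2 * (norm (position x u - position x v))\<^sup>2)"
    using edge by (simp add: fun_eq_iff constraint_fun_edge)
  ultimately show ?thesis
    using edge by (simp only:) (simp add: constraint_grad_def inner_rigidity_edge)
next
  case (loop l)
  have "((\<lambda>x. q l \<bullet> position x (anchor G l)) has_derivative (\<lambda>h. q l \<bullet> position h (anchor G l))) (at x)"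
    by (intro bounded_linear_imp_has_derivative
        bounded_linear_compose[OF bounded_linear_inner_right bounded_linear_position])
  moreover have "constraint_fun G q k = (\<lambda>x. q l \<bullet> position x (anchor G l))"
    using loop by (simp add: fun_eq_iff constraint_fun_loop)
  ultimately show ?thesis
    using loop by (simp add: constraint_grad_def inner_rigidity_loop)
next
  case (pin c)
  have "((\<lambda>x. x $ c) has_derivative (\<lambda>h. h $ c)) (at x)"
    by (intro bounded_linear_imp_has_derivative bounded_linear_vec_nth)
  then show ?thesis
    using pin by (simp add: constraint_fun_pin[abs_def] constraint_grad_def inner_axis')
qed

lemma constraint_grad_continuous: "continuous_on UNIV (constraint_grad G q k)"
proof (cases k)
  case (Inl r)
  have "continuous_on UNIV (\<lambda>x. rigidity_matrix G (position x) q $ r $ (w, i))" for w i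
  proof (cases r)
    case (Inl e)
    show ?thesis
      by (cases "e \<in> edges G \<and> w \<in> e")
        (auto simp: Inl rigidity_matrix_def position_def intro!: continuous_intros)
  qed (simp add: rigidity_matrix_def)
  then have "continuous_on UNIV (\<lambda>x. \<chi> c. rigidity_matrix G (position x) q $ r $ c)"
    by (intro continuous_on_vec_lambda) auto
  then show ?thesis using Inl by (simp add: constraint_grad_def[abs_def])
next
  case (Inr c)
  then show ?thesis by (simp add: constraint_grad_def[abs_def])
qed

lemma equivalent_if_constraints_eq:
  assumes G: "looped_simple_graph G"
    and eq: "\<And>k. k \<in> constraints G \<Longrightarrow> constraint_fun G q k x = constraint_fun G q k (configuration p)"
  shows "equivalent_frameworks G q p (position x)" "\<And>v. v \<notin> verts G \<Longrightarrow> position x v = p v"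
proof -
  show "equivalent_frameworks G q p (position x)"
    unfolding equivalent_frameworks_def
  proof (intro conjI allI impI ballI)
    fix u v assume uv: "{u, v} \<in> edges G"
    then have "u \<noteq> v" using G by (auto simp: looped_simple_graph_def)
    then show "norm (p u - p v) = norm (position x u - position x v)"
      using eq[of "Inl (Inl {u, v})"] uv by (simp add: constraint_fun_edge constraints_def)
  next
    fix l assume "l \<in> loops G"
    then show "p (anchor G l) \<bullet> q l = position x (anchor G l) \<bullet> q l"
      using eq[of "Inl (Inr l)"] by (simp add: constraint_fun_loop constraints_def inner_commute)
  qed
  show "position x v = p v" if "v \<notin> verts G" for v
    using eq[of "Inr (v, _)"] that
    by (auto simp: constraint_fun_pin constraints_def position_def configuration_def vec_eq_iff)
qed

text \<open>Global rigidity says nothing about vertices outside the graph; the pins fix those, so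
  the entire configuration is determined.\<close>

lemma globally_rigid_constraints:
  assumes "looped_simple_graph G" "globally_rigid G p q"
    and "\<And>k. k \<in> constraints G \<Longrightarrow> constraint_fun G q k x = constraint_fun G q k (configuration p)"
  shows "x = configuration p"
proof -
  have "position x = p"
    using equivalent_if_constraints_eq[OF assms(1,3)] assms(2) by (auto simp: globally_rigid_def)
  then show ?thesis by (metis configuration_eq_iff)
qed

text \<open>Rows of the rigidity matrix vanish in the columns of vertices outside the graph. They
  are thus orthogonal to the pin gradients, and the two dimensions add.\<close>

lemma dim_constraint_grad:
  fixes G :: "('v::finite, 'l::finite) lgraph" and q :: "'l \<Rightarrow> real^'d::finite"
  assumes "looped_simple_graph G"
  shows "dim ((\<lambda>k. constraint_grad G q k x) ` constraints G) =
    rank (rigidity_matrix G (position x) q) + card (- verts G) * CARD('d)"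
proof -
  let ?M = "rigidity_matrix G (position x) q"
  define A where "A = (\<lambda>r. ?M $ r) ` (Inl ` edges G \<union> Inr ` loops G)"
  define P where "P = (\<lambda>c. axis c 1 :: real^('v \<times> 'd)) ` ((- verts G) \<times> UNIV)"
  have "(\<lambda>k. constraint_grad G q k x) ` constraints G = A \<union> P"
    unfolding constraints_def A_def P_def image_Un image_image by (simp add: constraint_grad_def)
  moreover have "a \<bullet> b = 0" if "a \<in> A" "b \<in> P" for a b
  proof -
    obtain c where c: "b = axis c 1" "fst c \<notin> verts G" using \<open>b \<in> P\<close> by (auto simp: P_def)
    obtain r where r: "a = ?M $ r" "r \<in> Inl ` edges G \<union> Inr ` loops G"
      using \<open>a \<in> A\<close> by (auto simp: A_def)
    have "?M $ r $ c = 0"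
      using r(2) c(2) assms unfolding looped_simple_graph_def
      by (cases c) (fastforce simp: rigidity_matrix_def)
    then show ?thesis using c r by (simp add: inner_axis)
  qed
  then have "dim (A \<union> P) = dim A + dim P" by (rule dim_orthogonal_sum)
  moreover have "dim A = rank ?M"
  proof -
    have "?M $ r = 0" if "r \<notin> Inl ` edges G \<union> Inr ` loops G" for r
      using that by (cases r) (auto simp: rigidity_matrix_def vec_eq_iff image_iff)
    then have "rows ?M \<subseteq> insert 0 A" by (auto simp: rows_def row_def A_def vec_nth_inverse)
    then have "dim (rows ?M) \<le> dim A" using dim_subset dim_span span_insert_0 by metis
    moreover have "A \<subseteq> rows ?M" by (auto simp: rows_def row_def A_def vec_nth_inverse)
    ultimately show ?thesis using dim_subset[of A "rows ?M"] by (simp add: row_rank_def)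
  qed
  moreover have "dim P = card (- verts G) * CARD('d)"
  proof -
    have "P \<subseteq> Basis" by (auto simp: P_def axis_in_Basis_iff)
    then have "independent P" using independent_Basis independent_mono by blast
    moreover have "inj (\<lambda>c. axis c 1 :: real^('v \<times> 'd))" by (auto simp: inj_on_def axis_eq_axis)
    ultimately show ?thesis
      by (simp add: dim_eq_card_independent P_def card_image inj_on_subset card_cartesian_product)
  qed
  ultimately show ?thesis by simp
qed

lemma rigid_iff_dim_constraint_grad:
  fixes G :: "('v::finite, 'l::finite) lgraph"
  assumes "looped_simple_graph G"
  shows "rigid TYPE('d::finite) G \<longleftrightarrow>
    (\<exists>(q :: 'l \<Rightarrow> real^'d) x. dim ((\<lambda>k. constraint_grad G q k x) ` constraints G) = DIM(real^('v \<times> 'd)))"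
proof -
  have "card (verts G) + card (- verts G) = CARD('v)"
    using card_Un_disjoint[of "verts G" "- verts G"] by simp
  then have "CARD('d) * card (verts G) + card (- verts G) * CARD('d) = DIM(real^('v \<times> 'd))"
    by (simp add: algebra_simps flip: distrib_left)
  then have "rank (rigidity_matrix G (position x) q) = CARD('d) * card (verts G) \<longleftrightarrow>
      dim ((\<lambda>k. constraint_grad G q k x) ` constraints G) = DIM(real^('v \<times> 'd))"
    for q :: "'l \<Rightarrow> real^'d" and x
    unfolding dim_constraint_grad[OF assms] by linarith
  then show ?thesis
    unfolding rigid_def by (metis position_configuration)
qed

section \<open>Generic frameworks: transported velocities and maximal rank\<close>

definition framework_point :: "('v \<Rightarrow> real^'d) \<Rightarrow> ('l \<Rightarrow> real^'d) \<Rightarrow> ('v \<times> 'd) + ('l \<times> 'd) \<Rightarrow> real" where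
  "framework_point p q = case_sum (\<lambda>(v, i). p v $ i) (\<lambda>(l, i). q l $ i)"

lemma framework_point_simps [simp]:
  "framework_point p q (Inl c) = p (fst c) $ snd c" "framework_point p q (Inr c') = q (fst c') $ snd c'"
  by (simp_all add: framework_point_def case_prod_unfold)

abbreviation framework_vars :: "('v, 'l) lgraph \<Rightarrow> (('v \<times> 'd) + ('l \<times> 'd)) set" where
  "framework_vars G \<equiv> (verts G \<times> UNIV) <+> (loops G \<times> UNIV)"

lemma framework_vars_iff [simp]:
  "Inl (v, i) \<in> framework_vars G \<longleftrightarrow> v \<in> verts G" "Inr (l, i) \<in> framework_vars G \<longleftrightarrow> l \<in> loops G"
  by (auto simp: Plus_def)

lemma generic_framework_iff:
  "generic_framework G p q \<longleftrightarrow> alg_independent (framework_vars G) (framework_point p q)"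
  by (simp add: generic_framework_def framework_point_def)

lemma derivation_diff:
  assumes "derivation D"
  shows "D (a - b) = D a - D b"
proof -
  have "D a = D ((a - b) + b)" by simp
  also have "\<dots> = D (a - b) + D b" using assms unfolding derivation_def by blast
  finally show ?thesis by simp
qed

lemma derivation_inner:
  fixes a b :: "real^'n"
  assumes "derivation D"
  shows "D (a \<bullet> b) = a \<bullet> (\<chi> i. D (b $ i)) + (\<chi> i. D (a $ i)) \<bullet> b"
proof -
  have add: "D (a + b) = D a + D b" and mult: "D (a * b) = a * D b + D a * b" for a b
    using assms by (auto simp: derivation_def)
  have "D 0 = 0" using add[of 0 0] by simp
  then have "D (\<Sum>i\<in>A. f i) = (\<Sum>i\<in>A. D (f i))" for A and f :: "'n \<Rightarrow> real"
    by (induction A rule: infinite_finite_induct) (auto simp: add)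
  then show ?thesis by (simp add: inner_vec_def mult sum.distrib)
qed

text \<open>
  A derivation of the reals that moves the generic \<open>p\<close> with velocity \<open>w\<close> and kills \<open>q\<close> moves
  \<open>x\<close> with a velocity for which the common constraint values of \<open>x\<close> and \<open>p\<close> change equally.
\<close>

lemma velocity_transfer:
  fixes p :: "'v::finite \<Rightarrow> real^'d::finite" and G :: "('v, 'l::finite) lgraph"
  assumes G: "looped_simple_graph G" and gen: "generic_framework G p q" and A: "A \<subseteq> constraints G"
    and eq: "\<And>k. k \<in> A \<Longrightarrow> constraint_fun G q k x = constraint_fun G q k (configuration p)"
  obtains w' where "\<And>k. k \<in> A \<Longrightarrow>
    constraint_grad G q k x \<bullet> w' = constraint_grad G q k (configuration p) \<bullet> w"
proof -
  obtain D where D: "derivation D"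
    and Dval: "\<And>c. c \<in> framework_vars G \<Longrightarrow>
      D (framework_point p q c) = (case c of Inl c \<Rightarrow> w $ c | Inr _ \<Rightarrow> 0)"
    using alg_independent_derivation[OF gen[unfolded generic_framework_iff]] by metis
  define \<D> where "\<D> a = (\<chi> i. D (a $ i))" for a :: "real^'d"
  have Dp: "\<D> (p v) = position w v" if "v \<in> verts G" for v
  proof -
    have "D (p v $ i) = w $ (v, i)" for i using that Dval[of "Inl (v, i)"] by auto
    then show ?thesis by (simp add: \<D>_def position_def)
  qed
  have Dq: "\<D> (q l) = 0" if "l \<in> loops G" for l
  proof -
    have "D (q l $ i) = 0" for i using that Dval[of "Inr (l, i)"] by auto
    then show ?thesis by (simp add: \<D>_def vec_eq_iff)
  qed
  have D_inner: "D (a \<bullet> b) = a \<bullet> \<D> b + \<D> a \<bullet> b" for a b :: "real^'d"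
    unfolding \<D>_def by (rule derivation_inner[OF D])
  have D_diff: "\<D> (a - b) = \<D> a - \<D> b" for a b
    by (simp add: \<D>_def vec_eq_iff derivation_diff[OF D])
  \<comment> \<open>The derivation is prescribed only on coordinates of the graph. Elsewhere
    \<open>w'\<close> copies \<open>w\<close>, since a pin has the same gradient at \<open>x\<close>
    and at \<open>p\<close>.\<close>
  define w' where "w' = (\<chi> c. if fst c \<in> verts G then D (x $ c) else w $ c)"
  have w'_in: "position w' v = \<D> (position x v)" if "v \<in> verts G" for v
    using that by (simp add: w'_def position_def \<D>_def vec_eq_iff)
  have "constraint_grad G q k x \<bullet> w' = constraint_grad G q k (configuration p) \<bullet> w" if k: "k \<in> A" for k
  proof -
    have "k \<in> constraints G" using k A by blast
    with G show ?thesis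
    proof (cases rule: constraints_cases)
      case (edge u v)
      let ?x = "position x u - position x v" and ?p = "p u - p v"
      have "?x \<bullet> ?x = ?p \<bullet> ?p"
        using eq[OF k] edge by (simp add: constraint_fun_edge power2_norm_eq_inner)
      then have "D (?x \<bullet> ?x) = D (?p \<bullet> ?p)" by simp
      then have "?x \<bullet> \<D> ?x = ?p \<bullet> \<D> ?p" by (simp add: D_inner inner_commute)
      then show ?thesis
        using edge by (simp add: constraint_grad_def inner_rigidity_edge w'_in Dp D_diff)
    next
      case (loop l)
      let ?a = "anchor G l"
      have "q l \<bullet> position x ?a = q l \<bullet> p ?a"
        using eq[OF k] loop by (simp add: constraint_fun_loop)
      then have "D (q l \<bullet> position x ?a) = D (q l \<bullet> p ?a)" by simp
      then show ?thesis
        using loop by (simp add: constraint_grad_def inner_rigidity_loop D_inner w'_in Dp Dq)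
    next
      case (pin c)
      then show ?thesis by (simp add: constraint_grad_def inner_axis' w'_def)
    qed
  qed
  then show thesis by (rule that)
qed

text \<open>Gradient entries are integer polynomials in positions and loop directions jointly.
  Independent gradients at \<open>y\<close>, with the same \<open>q\<close>, therefore witness
  independence at the generic framework.\<close>

lemma constraint_grad_generic_rank:
  fixes p :: "'v::finite \<Rightarrow> real^'d::finite" and G :: "('v, 'l::finite) lgraph"
  assumes G: "looped_simple_graph G" and gen: "generic_framework G p q"
  shows "dim ((\<lambda>k. constraint_grad G q k y) ` constraints G) \<le>
    dim ((\<lambda>k. constraint_grad G q k (configuration p)) ` constraints G)"
proof -
  define z :: "('v, 'l, 'd) constraint \<Rightarrow> (('v \<times> 'd) + ('l \<times> 'd) \<Rightarrow> real) \<Rightarrow> real^('v \<times> 'd)"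
    where "z k a = constraint_grad G (\<lambda>l. \<chi> i. a (Inr (l, i))) k (\<chi> c. a (Inl c))" for k a
  have z_point: "z k (framework_point p' q) = constraint_grad G q k (configuration p')" for k p'
    by (simp add: z_def configuration_def)
  have y: "configuration (position y) = y" using configuration_eq_iff by blast
  obtain B where B: "B \<subseteq> (\<lambda>k. constraint_grad G q k y) ` constraints G" "independent B"
    "card B = dim ((\<lambda>k. constraint_grad G q k y) ` constraints G)"
    using basis_exists by metis
  obtain J where J: "J \<subseteq> constraints G" "inj_on (\<lambda>k. constraint_grad G q k y) J"
    "B = (\<lambda>k. constraint_grad G q k y) ` J"
    using B(1) by (auto simp: subset_image_inj)
  have z_poly: "(\<lambda>a. z k a $ c) \<in> int_polys (framework_vars G)" if "k \<in> J" for k c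
  proof -
    obtain w i where c: "c = (w, i)" by force
    have "k \<in> constraints G" using that J(1) by blast
    with G show ?thesis
    proof (cases rule: constraints_cases)
      case (edge u v)
      have var: "(\<lambda>a. a (Inl (v, i))) \<in> int_polys (framework_vars G)" if "v \<in> verts G" for v
        using that by (intro int_polys.var) auto
      consider "w = u" | "w = v" "w \<noteq> u" | "w \<noteq> u" "w \<noteq> v" by blast
      then show ?thesis
        using edge c
        by cases (auto simp: z_def constraint_grad_def rigidity_matrix_edge position_def
            intro!: int_polys.diff var int_polys_zero)
    next
      case (loop l)
      have "(\<lambda>a. a (Inr (l, i))) \<in> int_polys (framework_vars G)"
        using loop by (intro int_polys.var) auto
      then show ?thesis
        using loop c
        by (cases "w = anchor G l")
          (auto simp: z_def constraint_grad_def rigidity_matrix_def intro!: int_polys_zero)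
    next
      case (pin c')
      then show ?thesis
        by (cases "c = c'") (auto simp: z_def constraint_grad_def axis_def int_polys.one int_polys_zero)
    qed
  qed
  have "inj_on (\<lambda>k. z k (framework_point p q)) J" "independent ((\<lambda>k. z k (framework_point p q)) ` J)"
    using generic_independent[OF gen[unfolded generic_framework_iff] z_poly,
        where y = "framework_point (position y) q"]
      B(2) J(2,3) by (simp_all add: z_point y)
  then have "card B = card ((\<lambda>k. constraint_grad G q k (configuration p)) ` J)"
    and "independent ((\<lambda>k. constraint_grad G q k (configuration p)) ` J)"
    using J(2,3) by (simp_all add: z_point card_image)
  then show ?thesis
    using B(3) independent_card_le_dim[of "(\<lambda>k. constraint_grad G q k (configuration p)) ` J"] J(1)
    by (metis image_mono)
qed

lemma constraint_basis:
  fixes z :: "'k \<Rightarrow> 'a::euclidean_space"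
  obtains S where "S \<subseteq> K" "inj_on z S" "independent (z ` S)" "z ` K \<subseteq> span (z ` S)" "card S = dim (z ` K)"
proof -
  obtain B where B: "B \<subseteq> z ` K" "independent B" "z ` K \<subseteq> span B" "card B = dim (z ` K)"
    using basis_exists by metis
  obtain S where S: "S \<subseteq> K" "inj_on z S" "B = z ` S"
    using B(1) by (auto simp: subset_image_inj)
  then show thesis using that B by (metis card_image)
qed

text \<open>Genericity makes the rank at \<open>p\<close> maximal, so the constant rank result
  applies there; a deficient rank would yield another configuration with all constraint values
  unchanged.\<close>

lemma generic_globally_rigid_full_rank:
  fixes p :: "'v::finite \<Rightarrow> real^'d::finite" and G :: "('v, 'l::finite) lgraph"
  assumes G: "looped_simple_graph G" and gen: "generic_framework G p q" and rig: "globally_rigid G p q"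
  shows "dim ((\<lambda>k. constraint_grad G q k (configuration p)) ` constraints G) = DIM(real^('v \<times> 'd))"
proof (rule ccontr)
  let ?K = "constraints G :: ('v, 'l, 'd) constraint set" and ?P = "configuration p"
  assume "dim ((\<lambda>k. constraint_grad G q k ?P) ` ?K) \<noteq> DIM(real^('v \<times> 'd))"
  then have less: "dim ((\<lambda>k. constraint_grad G q k ?P) ` ?K) < DIM(real^('v \<times> 'd))"
    using dim_subset_UNIV[of "(\<lambda>k. constraint_grad G q k ?P) ` ?K"] by simp
  obtain S where S: "S \<subseteq> ?K" "inj_on (\<lambda>k. constraint_grad G q k ?P) S"
    "independent ((\<lambda>k. constraint_grad G q k ?P) ` S)"
    "card S = dim ((\<lambda>k. constraint_grad G q k ?P) ` ?K)"
    by (rule constraint_basis)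
  have rank: "dim ((\<lambda>k. constraint_grad G q k y) ` ?K) \<le> card S" for y
    using constraint_grad_generic_rank[OF G gen] S(4) by simp
  obtain U where U: "\<And>y k. y \<in> U \<Longrightarrow> (\<And>j. j \<in> S \<Longrightarrow> constraint_fun G q j y = constraint_fun G q j ?P) \<Longrightarrow>
      k \<in> ?K \<Longrightarrow> constraint_fun G q k y = constraint_fun G q k ?P"
    and U': "card S < DIM(real^('v \<times> 'd)) \<Longrightarrow>
      \<exists>y\<in>U. y \<noteq> ?P \<and> (\<forall>j\<in>S. constraint_fun G q j y = constraint_fun G q j ?P)"
    by (rule constant_rank_level_set[OF finite S(1) constraint_fun_has_derivative[OF G]
          constraint_grad_continuous S(2,3) rank]) blast+
  have "card S < DIM(real^('v \<times> 'd))" using less S(4) by (simp only:)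
  from U'[OF this] obtain y where y: "y \<in> U" "y \<noteq> ?P"
    "\<And>j. j \<in> S \<Longrightarrow> constraint_fun G q j y = constraint_fun G q j ?P" by blast
  have "y = ?P"
    by (rule globally_rigid_constraints[OF G rig]) (rule U[OF y(1) y(3)])
  then show False using y(2) by blast
qed

text \<open>
  If dropping \<open>k\<close> destroys rigidity, the level set of the remaining constraints through \<open>p\<close> is a
  closed curve, and the constraint \<open>k\<close> has non-zero derivative along it at \<open>p\<close>.
\<close>

lemma constraint_removal_full_rank:
  fixes p :: "'v::finite \<Rightarrow> real^'d::finite" and G :: "('v, 'l::finite) lgraph"
  assumes G: "looped_simple_graph G" and gen: "generic_framework G p q" and rig: "globally_rigid G p q"
    and k: "k \<in> constraints G"
    and bounded: "bounded {x. \<forall>j\<in>constraints G - {k}.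
      constraint_fun G q j x = constraint_fun G q j (configuration p)}"
  shows "\<exists>x. dim ((\<lambda>j. constraint_grad G q j x) ` (constraints G - {k})) = DIM(real^('v \<times> 'd))"
proof (rule ccontr)
  let ?K = "constraints G - {k} :: ('v, 'l, 'd) constraint set" and ?P = "configuration p"
  let ?N = "DIM(real^('v \<times> 'd))"
  assume "\<not> ?thesis"
  then have less: "dim ((\<lambda>j. constraint_grad G q j x) ` ?K) < ?N" for x
    using dim_subset_UNIV[of "(\<lambda>j. constraint_grad G q j x) ` ?K"] by (metis le_neq_implies_less)
  obtain S where S: "S \<subseteq> ?K" "inj_on (\<lambda>k. constraint_grad G q k ?P) S"
    "independent ((\<lambda>k. constraint_grad G q k ?P) ` S)"
    "(\<lambda>k. constraint_grad G q k ?P) ` ?K \<subseteq> span ((\<lambda>k. constraint_grad G q k ?P) ` S)"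
    "card S = dim ((\<lambda>k. constraint_grad G q k ?P) ` ?K)"
    by (rule constraint_basis)
  \<comment> \<open>All constraints together have full rank at \<open>?P\<close> and the remaining
    ones do not. So \<open>k\<close> contributes exactly one dimension, and its gradient lies
    outside their span.\<close>
  have "insert (constraint_grad G q k ?P) ((\<lambda>j. constraint_grad G q j ?P) ` ?K) =
      (\<lambda>j. constraint_grad G q j ?P) ` constraints G"
    using k by auto
  then have "dim (insert (constraint_grad G q k ?P) ((\<lambda>j. constraint_grad G q j ?P) ` ?K)) = ?N"
    using generic_globally_rigid_full_rank[OF G gen rig] by simp
  then have "constraint_grad G q k ?P \<notin> span ((\<lambda>j. constraint_grad G q j ?P) ` ?K)"
    and card: "card S + 1 = ?N"
    using less[of ?P] S(5) by (auto simp: dim_insert split: if_splits)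
  then have notin: "constraint_grad G q k ?P \<notin> span ((\<lambda>j. constraint_grad G q j ?P) ` S)"
    using span_mono[OF image_mono[OF S(1)]] by blast
  \<comment> \<open>As \<open>x\<close> may be non-generic, solvability is carried over from
    \<open>?P\<close> by transferred velocities.\<close>
  have indep: "inj_on (\<lambda>j. constraint_grad G q j x) S \<and> independent ((\<lambda>j. constraint_grad G q j x) ` S)"
    if x: "\<And>j. j \<in> ?K \<Longrightarrow> constraint_fun G q j x = constraint_fun G q j ?P" for x
  proof -
    have "\<exists>w. \<forall>j\<in>S. constraint_grad G q j x \<bullet> w = c j" for c
    proof -
      obtain w where w: "\<And>j. j \<in> S \<Longrightarrow> constraint_grad G q j ?P \<bullet> w = c j"
        using independent_family_solve[OF S(2,3)] by blast
      obtain w' where "\<And>j. j \<in> ?K \<Longrightarrow> constraint_grad G q j x \<bullet> w' = constraint_grad G q j ?P \<bullet> w"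
        using velocity_transfer[OF G gen _ x, of ?K w] by blast
      then show ?thesis using w S(1) by (metis subsetD)
    qed
    then show ?thesis using independent_familyI[of S "\<lambda>j. constraint_grad G q j x"] by blast
  qed
  have "\<exists>x. x \<noteq> ?P \<and> (\<forall>j\<in>?K. constraint_fun G q j x = constraint_fun G q j ?P) \<and>
      constraint_fun G q k x = constraint_fun G q k ?P"
  proof (rule level_set_meets_twice[OF finite S(1)])
    show "(constraint_fun G q j has_derivative (\<bullet>) (constraint_grad G q j y)) (at y)" if "j \<in> ?K" for j y
      using that constraint_fun_has_derivative[OF G] by blast
    show "continuous_on UNIV (constraint_grad G q j)" for j by (rule constraint_grad_continuous)
    show "dim ((\<lambda>j. constraint_grad G q j y) ` ?K) \<le> card S" for y using less[of y] card by simp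
    show "card S + 1 = ?N" by (rule card)
    show "bounded {x. \<forall>j\<in>?K. constraint_fun G q j x = constraint_fun G q j ?P}" by (rule bounded)
    show "continuous_on UNIV (constraint_fun G q k)"
      using constraint_fun_has_derivative[OF G k] by (rule has_derivative_continuous_on)
    show "(constraint_fun G q k has_derivative (\<bullet>) (constraint_grad G q k ?P)) (at ?P)"
      by (rule constraint_fun_has_derivative[OF G k])
  qed (use indep notin in blast)+
  then obtain x where "x \<noteq> ?P" "\<forall>j\<in>constraints G. constraint_fun G q j x = constraint_fun G q j ?P" by blast
  then show False using globally_rigid_constraints[OF G rig] by blast
qed

section \<open>Components of globally rigid frameworks\<close>

definition adjacency :: "('v, 'l) lgraph \<Rightarrow> 'v rel" where
  "adjacency G = {(u, v). {u, v} \<in> edges G}"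

lemma connectivity_iff:
  "(u, v) \<in> connectivity G \<longleftrightarrow> (u, v) \<in> (adjacency G)\<^sup>* \<and> u \<in> verts G \<and> v \<in> verts G"
  by (auto simp: connectivity_def adjacency_def)

lemma adjacency_sym: "(u, v) \<in> (adjacency G)\<^sup>* \<Longrightarrow> (v, u) \<in> (adjacency G)\<^sup>*"
proof -
  have "sym (adjacency G)" by (auto simp: sym_def adjacency_def insert_commute)
  then show "(u, v) \<in> (adjacency G)\<^sup>* \<Longrightarrow> (v, u) \<in> (adjacency G)\<^sup>*"
    by (meson sym_rtrancl symD)
qed

lemma graph_component_cases:
  assumes G: "looped_simple_graph G" and H: "H \<in> graph_components G"
  obtains v where "v \<in> verts G" "verts H = {u \<in> verts G. (v, u) \<in> (adjacency G)\<^sup>*}"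
    "H = induced_subgraph G (verts H)"
    "\<And>u w. {u, w} \<in> edges G \<Longrightarrow> u \<in> verts H \<longleftrightarrow> w \<in> verts H"
proof -
  obtain v where v: "v \<in> verts G" and H_eq: "H = induced_subgraph G (connectivity G `` {v})"
    using H by (auto simp: graph_components_def elim: quotientE)
  have vH: "verts H = {u \<in> verts G. (v, u) \<in> (adjacency G)\<^sup>*}"
    using v by (auto simp: H_eq induced_subgraph_def connectivity_iff)
  have "connectivity G `` {v} = verts H"
    using v by (auto simp: vH connectivity_iff)
  then have H_eq': "H = induced_subgraph G (verts H)" using H_eq by simp
  have closed: "w \<in> verts H" if "{u, w} \<in> edges G" "u \<in> verts H" for u w
    using that G rtrancl_into_rtrancl[of v u "adjacency G" w]
    by (auto simp: vH adjacency_def looped_simple_graph_def)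
  have "u \<in> verts H \<longleftrightarrow> w \<in> verts H" if "{u, w} \<in> edges G" for u w
    using that closed[of u w] closed[of w u] by (auto simp: insert_commute)
  then show thesis by (rule that[OF v vH H_eq'])
qed

lemma looped_simple_induced_subgraph:
  "looped_simple_graph G \<Longrightarrow> looped_simple_graph (induced_subgraph G W)"
  by (auto simp: looped_simple_graph_def induced_subgraph_def)

lemma graph_component_connected:
  assumes G: "looped_simple_graph G" and H: "H \<in> graph_components G"
    and uw: "u \<in> verts H" "w \<in> verts H"
  shows "(u, w) \<in> (adjacency H)\<^sup>*"
proof -
  obtain v where v: "v \<in> verts G" "verts H = {u \<in> verts G. (v, u) \<in> (adjacency G)\<^sup>*}"
    and H_eq: "H = induced_subgraph G (verts H)"
    and closed: "\<And>u w. {u, w} \<in> edges G \<Longrightarrow> u \<in> verts H \<longleftrightarrow> w \<in> verts H"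
    by (rule graph_component_cases[OF G H]) blast
  have edges: "edges H = {e \<in> edges G. e \<subseteq> verts H}"
    by (subst H_eq) (simp add: induced_subgraph_def)
  have vH: "v \<in> verts H" using v by simp
  have "x \<in> verts H \<and> (v, x) \<in> (adjacency H)\<^sup>*" if "(v, x) \<in> (adjacency G)\<^sup>*" for x
    using that
  proof induction
    case base
    then show ?case using vH by simp
  next
    case (step x y)
    then have xy: "{x, y} \<in> edges G" "y \<in> verts H" using closed by (auto simp: adjacency_def)
    then have "(x, y) \<in> adjacency H" using step by (auto simp: adjacency_def edges)
    then show ?case using step xy by (meson rtrancl_into_rtrancl)
  qed
  then have "(v, u) \<in> (adjacency H)\<^sup>*" "(v, w) \<in> (adjacency H)\<^sup>*" using uw v(2) by auto
  then show ?thesis using adjacency_sym rtrancl_trans by metis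
qed

lemma generic_framework_mono:
  assumes "generic_framework G p q" "verts H \<subseteq> verts G" "loops H \<subseteq> loops G"
  shows "generic_framework H p q"
proof -
  have "framework_vars H \<subseteq> framework_vars G" using assms(2,3) by auto
  then show ?thesis using assms(1) unfolding generic_framework_iff alg_independent_def by blast
qed

text \<open>No edge leaves a component, so another realisation of it, extended by \<open>p\<close>,
  is one of the whole graph.\<close>

lemma graph_component_globally_rigid:
  assumes G: "looped_simple_graph G" and H: "H \<in> graph_components G" and rig: "globally_rigid G p q"
  shows "globally_rigid H p q"
  unfolding globally_rigid_def
proof (intro allI impI)
  fix p' assume p': "equivalent_frameworks H q p p'"
  obtain H_eq: "H = induced_subgraph G (verts H)"
    and closed: "\<And>u w. {u, w} \<in> edges G \<Longrightarrow> u \<in> verts H \<longleftrightarrow> w \<in> verts H"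
    and sub: "verts H \<subseteq> verts G"
    by (rule graph_component_cases[OF G H]) blast
  have parts: "edges H = {e \<in> edges G. e \<subseteq> verts H}" "loops H = {l \<in> loops G. anchor G l \<in> verts H}"
    "anchor H = anchor G"
    by (subst H_eq, simp add: induced_subgraph_def)+
  define p'' where "p'' v = (if v \<in> verts H then p' v else p v)" for v
  have "equivalent_frameworks G q p p''"
    unfolding equivalent_frameworks_def
  proof (intro conjI allI impI ballI)
    fix u v assume uv: "{u, v} \<in> edges G"
    then have "{u, v} \<in> edges H" if "u \<in> verts H" using that closed[OF uv] by (auto simp: parts)
    then show "norm (p u - p v) = norm (p'' u - p'' v)"
      using p' closed[OF uv] by (auto simp: p''_def equivalent_frameworks_def)
  next
    fix l assume "l \<in> loops G"
    then show "p (anchor G l) \<bullet> q l = p'' (anchor G l) \<bullet> q l"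
      using p' by (auto simp: p''_def equivalent_frameworks_def parts)
  qed
  then have eq: "p'' v = p v" if "v \<in> verts G" for v
    using rig that by (auto simp: globally_rigid_def)
  show "\<forall>v\<in>verts H. p' v = p v"
  proof
    fix v assume "v \<in> verts H"
    then show "p' v = p v" using eq[of v] sub by (auto simp: p''_def)
  qed
qed

text \<open>Edges bound the distances between connected vertices, and a loop fixes one inner product
  at its anchor. Carried along paths, the loops of a component bound every coordinate once their
  directions span the space.\<close>

lemma constraints_bounded:
  fixes q :: "'l::finite \<Rightarrow> real^'d::finite" and G :: "('v::finite, 'l) lgraph"
  assumes G: "looped_simple_graph G"
    and span: "\<And>v. v \<in> verts G \<Longrightarrow> span (q ` {l \<in> loops G. (anchor G l, v) \<in> (adjacency G)\<^sup>*}) = UNIV"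
  shows "bounded {x. \<forall>k\<in>constraints G. constraint_fun G q k x = c k}" (is "bounded ?F")
proof -
  have path: "\<exists>C. \<forall>x\<in>?F. norm (position x u - position x v) \<le> C" if "(u, v) \<in> (adjacency G)\<^sup>*" for u v
    using that
  proof induction
    case base
    show ?case by (rule exI[of _ 0]) simp
  next
    case (step v w)
    then obtain C where C: "\<And>x. x \<in> ?F \<Longrightarrow> norm (position x u - position x v) \<le> C" by blast
    have vw: "{v, w} \<in> edges G" using step by (simp add: adjacency_def)
    then have "v \<noteq> w" using G by (auto simp: looped_simple_graph_def)
    have "norm (position x u - position x w) \<le> C + sqrt (2 * c (Inl (Inl {v, w})))" if x: "x \<in> ?F" for x
    proof -
      have "1/2 * (norm (position x v - position x w))\<^sup>2 = c (Inl (Inl {v, w}))"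
      proof -
        have "Inl (Inl {v, w}) \<in> constraints G" using vw by (simp add: constraints_def)
        then have "constraint_fun G q (Inl (Inl {v, w})) x = c (Inl (Inl {v, w}))" using x by blast
        then show ?thesis by (simp add: constraint_fun_edge[OF vw \<open>v \<noteq> w\<close>])
      qed
      then have "norm (position x v - position x w) = sqrt (2 * c (Inl (Inl {v, w})))"
        by (simp add: real_sqrt_unique[symmetric])
      then show ?thesis
        using C[OF x] norm_triangle_ineq[of "position x u - position x v" "position x v - position x w"] by simp
    qed
    then show ?case by blast
  qed
  have coord: "\<exists>C. \<forall>x\<in>?F. \<bar>x $ (v, i)\<bar> \<le> C" for v i
  proof (cases "v \<in> verts G")
    case False
    then have "x $ (v, i) = c (Inr (v, i))" if "x \<in> ?F" for x
    proof -
      have "Inr (v, i) \<in> constraints G" using False by (simp add: constraints_def)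
      then have "constraint_fun G q (Inr (v, i)) x = c (Inr (v, i))" using that by blast
      then show ?thesis by (simp add: constraint_fun_pin)
    qed
    then show ?thesis by (intro exI[of _ "\<bar>c (Inr (v, i))\<bar>"]) simp
  next
    case True
    \<comment> \<open>The vectors whose inner product with the position of \<open>v\<close> is
      bounded form a subspace; it contains the spanning loop directions.\<close>
    let ?B = "{z. \<exists>C. \<forall>x\<in>?F. \<bar>z \<bullet> position x v\<bar> \<le> C}"
    have subspace: "subspace ?B"
    proof (rule subspaceI)
      show "0 \<in> ?B" by (auto intro: exI[of _ 0])
      fix y z assume "y \<in> ?B" "z \<in> ?B"
      then obtain C C' where "\<And>x. x \<in> ?F \<Longrightarrow> \<bar>y \<bullet> position x v\<bar> \<le> C" "\<And>x. x \<in> ?F \<Longrightarrow> \<bar>z \<bullet> position x v\<bar> \<le> C'"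
        by blast
      then have "\<bar>(y + z) \<bullet> position x v\<bar> \<le> C + C'" if "x \<in> ?F" for x
        using that by (smt (verit) inner_add_left)
      then show "y + z \<in> ?B" by blast
    next
      fix r z assume "z \<in> ?B"
      then obtain C where C: "\<And>x. x \<in> ?F \<Longrightarrow> \<bar>z \<bullet> position x v\<bar> \<le> C" by blast
      have "\<bar>(r *\<^sub>R z) \<bullet> position x v\<bar> \<le> \<bar>r\<bar> * C" if "x \<in> ?F" for x
        using C[OF that] by (simp add: abs_mult mult_left_mono)
      then show "r *\<^sub>R z \<in> ?B" by blast
    qed
    have "q l \<in> ?B" if l: "l \<in> loops G" "(anchor G l, v) \<in> (adjacency G)\<^sup>*" for l
    proof -
      obtain C where C: "\<And>x. x \<in> ?F \<Longrightarrow> norm (position x (anchor G l) - position x v) \<le> C"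
        using path[OF l(2)] by blast
      have "\<bar>q l \<bullet> position x v\<bar> \<le> \<bar>c (Inl (Inr l))\<bar> + norm (q l) * C" if x: "x \<in> ?F" for x
      proof -
        have "q l \<bullet> position x (anchor G l) = c (Inl (Inr l))"
        proof -
          have "Inl (Inr l) \<in> constraints G" using l(1) by (simp add: constraints_def)
          then have "constraint_fun G q (Inl (Inr l)) x = c (Inl (Inr l))" using x by blast
          then show ?thesis by (simp add: constraint_fun_loop[OF l(1)])
        qed
        moreover have "\<bar>q l \<bullet> (position x (anchor G l) - position x v)\<bar> \<le> norm (q l) * C"
          using Cauchy_Schwarz_ineq2[of "q l" "position x (anchor G l) - position x v"] C[OF x]
          by (meson mult_left_mono norm_ge_zero order_trans)
        ultimately show ?thesis by (simp add: inner_diff_right)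
      qed
      then show ?thesis by blast
    qed
    then have "q ` {l \<in> loops G. (anchor G l, v) \<in> (adjacency G)\<^sup>*} \<subseteq> ?B" by blast
    from span_minimal[OF this subspace] have "axis i 1 \<in> ?B" unfolding span[OF True] by blast
    then show ?thesis by (simp add: inner_axis' position_def)
  qed
  then have "\<forall>j. \<exists>C. \<forall>x\<in>?F. \<bar>x $ j\<bar> \<le> C" by (simp add: split_paired_all)
  from choice[OF this] obtain C where C: "\<And>j x. x \<in> ?F \<Longrightarrow> \<bar>x $ j\<bar> \<le> C j" by blast
  have "norm x \<le> (\<Sum>j\<in>UNIV. C j)" if "x \<in> ?F" for x
    by (rule order_trans[OF norm_le_l1_cart sum_mono]) (rule C[OF that])
  then show ?thesis unfolding bounded_iff by blast
qed

section \<open>General position of loop directions, edge vectors and points\<close>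

lemma generic_family_independent:
  fixes p :: "'v \<Rightarrow> real^'d::finite" and z :: "'j \<Rightarrow> ('v \<times> 'd + 'l \<times> 'd \<Rightarrow> real) \<Rightarrow> real^'d"
  assumes gen: "generic_framework G p q" and J: "finite J" "card J \<le> CARD('d)"
    and z: "\<And>j k. j \<in> J \<Longrightarrow> (\<lambda>a. z j a $ k) \<in> int_polys (framework_vars G)"
    and special: "\<And>e. inj_on e J \<Longrightarrow> \<exists>a. \<forall>j\<in>J. z j a = axis (e j) 1"
  shows "inj_on (\<lambda>j. z j (framework_point p q)) J"
    "independent ((\<lambda>j. z j (framework_point p q)) ` J)"
proof -
  \<comment> \<open>Distinct coordinate vectors are the special independent family; the cardinality
    bound makes room for them.\<close>
  obtain e :: "'j \<Rightarrow> 'd" where e: "inj_on e J"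
    using card_le_inj[OF J(1) finite[of "UNIV :: 'd set"]] J(2) by auto
  obtain a where a: "\<And>j. j \<in> J \<Longrightarrow> z j a = axis (e j) 1" using special[OF e] by blast
  then have inj: "inj_on (\<lambda>j. z j a) J" using e by (auto simp: inj_on_def axis_eq_axis)
  have "(\<lambda>j. z j a) ` J \<subseteq> Basis" using a by (auto simp: axis_in_Basis_iff)
  then have ind: "independent ((\<lambda>j. z j a) ` J)" using independent_Basis independent_mono by blast
  show "inj_on (\<lambda>j. z j (framework_point p q)) J"
    "independent ((\<lambda>j. z j (framework_point p q)) ` J)"
    by (rule generic_independent[OF gen[unfolded generic_framework_iff] z inj ind]; assumption)+
qed

lemma generic_loops_independent:
  fixes q :: "'l::finite \<Rightarrow> real^'d::finite"
  assumes gen: "generic_framework G p q" and T: "T \<subseteq> loops G" "card T \<le> CARD('d)"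
  shows "inj_on q T" "independent (q ` T)"
proof -
  define z where "z l a = (\<chi> i. a (Inr (l, i)))" for l :: 'l and a :: "('a \<times> 'd) + ('l \<times> 'd) \<Rightarrow> real"
  have "(\<lambda>a. z l a $ k) \<in> int_polys (framework_vars G)" if "l \<in> T" for l k
    using that T(1) by (auto simp: z_def intro!: int_polys.var)
  moreover have "\<exists>a. \<forall>l\<in>T. z l a = axis (e l) 1" for e :: "'l \<Rightarrow> 'd"
    by (rule exI[of _ "framework_point (\<lambda>_. 0) (\<lambda>l. axis (e l) 1)"]) (simp add: z_def)
  ultimately have "inj_on (\<lambda>l. z l (framework_point p q)) T"
    "independent ((\<lambda>l. z l (framework_point p q)) ` T)"
    using generic_family_independent[OF gen _ T(2), of z] by auto
  then show "inj_on q T" "independent (q ` T)" by (simp_all add: z_def)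
qed

lemma generic_loops_span:
  fixes q :: "'l::finite \<Rightarrow> real^'d::finite"
  assumes gen: "generic_framework G p q" and T: "T \<subseteq> loops G" "CARD('d) \<le> card T"
  shows "span (q ` T) = UNIV"
proof -
  obtain T' where T': "T' \<subseteq> T" "card T' = CARD('d)"
    using T(2) by (meson obtain_subset_with_card_n)
  then have "inj_on q T'" "independent (q ` T')"
    using generic_loops_independent[OF gen, of T'] T(1) by auto
  then have "span (q ` T') = UNIV"
    using card_eq_dim[of "q ` T'" UNIV] T'(2) by (simp add: card_image top.extremum_unique)
  then show ?thesis using span_mono[OF image_mono[OF T'(1)], of q] by blast
qed

text \<open>The edge vector, indexed by \<open>None\<close>, and fewer than \<open>d\<close> loop
  directions are at most \<open>d\<close> vectors, hence independent. The solution \<open>x\<close>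
  is a direction of translation that the loops in \<open>T\<close> do not notice but the edge
  does.\<close>

lemma generic_edge_direction:
  fixes p :: "'v \<Rightarrow> real^'d::finite" and q :: "'l::finite \<Rightarrow> real^'d"
  assumes gen: "generic_framework G p q" and T: "T \<subseteq> loops G" "card T < CARD('d)"
    and uv: "u \<in> verts G" "v \<in> verts G" "u \<noteq> v"
  obtains x where "x \<bullet> (p u - p v) = 1" "\<And>l. l \<in> T \<Longrightarrow> x \<bullet> q l = 0"
proof -
  define z where "z j a = (case j of None \<Rightarrow> (\<chi> i. a (Inl (u, i)) - a (Inl (v, i)))
    | Some l \<Rightarrow> (\<chi> i. a (Inr (l, i))))" for j and a :: "('v \<times> 'd) + ('l \<times> 'd) \<Rightarrow> real"
  let ?J = "insert None (Some ` T)"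
  have J: "finite ?J" "card ?J \<le> CARD('d)"
    using T(2) by (auto simp: card_insert_if card_image)
  have poly: "(\<lambda>a. z j a $ k) \<in> int_polys (framework_vars G)" if "j \<in> ?J" for j k
    using that T(1) uv by (auto simp: z_def intro!: int_polys.var int_polys.diff)
  have special: "\<exists>a. \<forall>j\<in>?J. z j a = axis (e j) 1" for e :: "'l option \<Rightarrow> 'd"
    by (rule exI[of _ "framework_point (\<lambda>w. if w = u then axis (e None) 1 else 0) (\<lambda>l. axis (e (Some l)) 1)"])
       (use uv in \<open>auto simp: z_def\<close>)
  have "inj_on (\<lambda>j. z j (framework_point p q)) ?J"
    "independent ((\<lambda>j. z j (framework_point p q)) ` ?J)"
    by (rule generic_family_independent[OF gen J poly special]; assumption)+
  from independent_family_solve[OF this, of "\<lambda>j. if j = None then 1 else 0"]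
  obtain x where x: "\<And>j. j \<in> ?J \<Longrightarrow> z j (framework_point p q) \<bullet> x = (if j = None then 1 else 0)" by blast
  have z_point: "z None (framework_point p q) = p u - p v" "z (Some l) (framework_point p q) = q l" for l
    by (auto simp: z_def vec_eq_iff)
  show thesis
  proof (rule that)
    show "x \<bullet> (p u - p v) = 1" using x[of None] by (simp add: z_point inner_commute)
    show "x \<bullet> q l = 0" if "l \<in> T" for l
      using x[of "Some l"] that by (simp add: z_point inner_commute)
  qed
qed

text \<open>The special position has \<open>v\<close> at the origin and \<open>Y\<close> at distinct
  unit vectors. For \<open>card Y = d\<close> the result says that \<open>d + 1\<close> generic
  points lie in no common hyperplane.\<close>

lemma generic_affinely_independent:
  fixes p :: "'v::finite \<Rightarrow> real^'d::finite" and q :: "'l \<Rightarrow> real^'d"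
  assumes gen: "generic_framework G p q" and Y: "Y \<subseteq> verts G" "card Y \<le> CARD('d)"
    and v: "v \<in> verts G" "v \<notin> Y"
  shows "inj_on (\<lambda>y. p y - p v) Y" "independent ((\<lambda>y. p y - p v) ` Y)"
proof -
  define z where "z y a = (\<chi> i. a (Inl (y, i)) - a (Inl (v, i)))"
    for y and a :: "('v \<times> 'd) + ('l \<times> 'd) \<Rightarrow> real"
  have "(\<lambda>a. z y a $ k) \<in> int_polys (framework_vars G)" if "y \<in> Y" for y k
    using that Y(1) v by (auto simp: z_def intro!: int_polys.var int_polys.diff)
  moreover have "\<exists>a. \<forall>y\<in>Y. z y a = axis (e y) 1" for e :: "'v \<Rightarrow> 'd"
    by (rule exI[of _ "framework_point (\<lambda>w. if w = v then 0 else axis (e w) 1) (\<lambda>_. 0)"])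
       (use v in \<open>auto simp: z_def vec_eq_iff\<close>)
  ultimately have "inj_on (\<lambda>y. z y (framework_point p q)) Y"
    "independent ((\<lambda>y. z y (framework_point p q)) ` Y)"
    using generic_family_independent[OF gen _ Y(2), of z] by auto
  moreover have "z y (framework_point p q) = p y - p v" for y by (simp add: z_def vec_eq_iff)
  ultimately show "inj_on (\<lambda>y. p y - p v) Y" "independent ((\<lambda>y. p y - p v) ` Y)" by simp_all
qed

lemma looped_simple_delete_edge: "looped_simple_graph G \<Longrightarrow> looped_simple_graph (delete_edge G e)"
  by (auto simp: looped_simple_graph_def delete_edge_def)

lemma looped_simple_delete_loop: "looped_simple_graph G \<Longrightarrow> looped_simple_graph (delete_loop G l)"
  by (auto simp: looped_simple_graph_def delete_loop_def)

lemma constraints_delete_edge: "constraints (delete_edge G e) = constraints G - {Inl (Inl e)}"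
  by (auto simp: constraints_def delete_edge_def)

lemma constraints_delete_loop: "constraints (delete_loop G l) = constraints G - {Inl (Inr l)}"
  by (auto simp: constraints_def delete_loop_def)

lemma constraint_grad_delete_edge:
  "k \<noteq> Inl (Inl e) \<Longrightarrow> constraint_grad (delete_edge G e) q k x = constraint_grad G q k x"
  by (auto simp: constraint_grad_def rigidity_matrix_def delete_edge_def vec_eq_iff split: sum.split)

lemma constraint_grad_delete_loop:
  "k \<noteq> Inl (Inr l) \<Longrightarrow> constraint_grad (delete_loop G l) q k x = constraint_grad G q k x"
  by (auto simp: constraint_grad_def rigidity_matrix_def delete_loop_def vec_eq_iff split: sum.split)

text \<open>Besides giving the isometry for balancedness, the identity tells how far a vector must
  be translated along \<open>a\<close> to regain its length.\<close>

lemma norm_reflection: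
  fixes a y :: "'a::real_inner"
  assumes "a \<noteq> 0"
  shows "norm (y - (2 * (a \<bullet> y) / (a \<bullet> a)) *\<^sub>R a) = norm y"
proof -
  define s where "s = 2 * (a \<bullet> y) / (a \<bullet> a)"
  have "s * (a \<bullet> a) = 2 * (a \<bullet> y)" using assms by (simp add: s_def)
  then have "s * (s * (a \<bullet> a)) = s * (2 * (a \<bullet> y))" by simp
  then have "(y - s *\<^sub>R a) \<bullet> (y - s *\<^sub>R a) = y \<bullet> y"
    by (simp add: inner_diff_left inner_diff_right inner_commute algebra_simps)
  then show ?thesis by (simp add: norm_eq s_def)
qed

section \<open>Connected generic globally rigid frameworks\<close>

context
  fixes H :: "('v::finite, 'l::finite) lgraph" and p :: "'v \<Rightarrow> real^'d::finite" and q :: "'l \<Rightarrow> real^'d"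
  assumes H: "looped_simple_graph H" and gen: "generic_framework H p q" and rig: "globally_rigid H p q"
    and connected: "\<And>u w. u \<in> verts H \<Longrightarrow> w \<in> verts H \<Longrightarrow> (u, w) \<in> (adjacency H)\<^sup>*"
begin

lemma rigid_contradiction:
  assumes "equivalent_frameworks H q p p'" "v \<in> verts H"
  shows "p' v = p v"
  using rig assms by (auto simp: globally_rigid_def)

text \<open>Fewer than \<open>d\<close> loop directions leave a nonzero vector orthogonal to all of
  them, along which the vertex could be moved.\<close>

lemma single_vertex_loops:
  assumes v: "verts H = {v}"
  shows "CARD('d) \<le> card (loops H)"
proof (rule ccontr)
  assume "\<not> ?thesis"
  moreover have "dim (q ` loops H) \<le> card (loops H)"
    using dim_le_card'[of "q ` loops H"] card_image_le[of "loops H" q] by simp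
  ultimately have "dim (q ` loops H) < DIM(real^'d)" by simp
  then obtain x where x: "x \<noteq> 0" "\<And>y. y \<in> span (q ` loops H) \<Longrightarrow> orthogonal x y"
    using orthogonal_to_subspace_exists by blast
  have orth: "x \<bullet> q l = 0" if "l \<in> loops H" for l
    using x(2)[of "q l"] that by (simp add: orthogonal_def span_base)
  have "edges H = {}"
  proof (rule ccontr)
    assume "edges H \<noteq> {}"
    then obtain e where "e \<in> edges H" by blast
    then obtain u w where "u \<noteq> w" "u \<in> verts H" "w \<in> verts H" by (rule edge_doubleton[OF H])
    then show False using v by simp
  qed
  then have "equivalent_frameworks H q p (\<lambda>w. p w + x)"
    using orth by (auto simp: equivalent_frameworks_def inner_add_left)
  then show False using rigid_contradiction[of "\<lambda>w. p w + x" v] v x(1) by simp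
qed

lemma generic_positions_distinct:
  assumes "u \<in> verts H" "v \<in> verts H" "u \<noteq> v"
  shows "p u \<noteq> p v"
proof -
  obtain x where "x \<bullet> (p u - p v) = 1"
    using generic_edge_direction[OF gen empty_subsetI _ assms] by auto
  then show ?thesis by auto
qed

text \<open>At most \<open>d\<close> generic loops do not fix the centre of a point reflection.\<close>

lemma card_loops_gt:
  assumes uv: "u \<in> verts H" "v \<in> verts H" "u \<noteq> v"
  shows "CARD('d) < card (loops H)"
proof (rule ccontr)
  assume "\<not> ?thesis"
  then have "inj_on q (loops H)" "independent (q ` loops H)"
    using generic_loops_independent[OF gen order_refl] by auto
  from independent_family_solve[OF this, of "\<lambda>l. 2 * (q l \<bullet> p (anchor H l))"]
  obtain t where t: "\<And>l. l \<in> loops H \<Longrightarrow> q l \<bullet> t = 2 * (q l \<bullet> p (anchor H l))" by blast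
  have "p (anchor H l) \<bullet> q l = (t - p (anchor H l)) \<bullet> q l" if "l \<in> loops H" for l
    using t[OF that] by (simp add: inner_commute[of _ "q l"] inner_diff_right)
  then have "equivalent_frameworks H q p (\<lambda>w. t - p w)"
    by (simp add: equivalent_frameworks_def norm_minus_commute)
  then have "t - p u = p u" "t - p v = p v" using rigid_contradiction uv by blast+
  then have "2 *\<^sub>R p u = 2 *\<^sub>R p v" by (simp add: scaleR_2 algebra_simps)
  then show False using generic_positions_distinct[OF uv] by simp
qed

text \<open>
  A component of \<open>H - e\<close> with fewer than \<open>d\<close> loops can be translated orthogonally to all of its loop
  directions until the length of \<open>e\<close> is restored.
\<close>

lemma card_loops_edge_removal:
  assumes e: "e \<in> edges H" and w: "w \<in> verts H"
  shows "CARD('d) \<le> card {l \<in> loops H. (anchor H l, w) \<in> (adjacency (delete_edge H e))\<^sup>*}"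
proof (rule ccontr)
  let ?A = "adjacency (delete_edge H e)"
  define C where "C = {y. (w, y) \<in> ?A\<^sup>*}"
  define T where "T = {l \<in> loops H. anchor H l \<in> C}"
  assume "\<not> ?thesis"
  moreover have "{l \<in> loops H. (anchor H l, w) \<in> ?A\<^sup>*} = T"
    unfolding T_def C_def by (auto intro: adjacency_sym)
  ultimately have T: "T \<subseteq> loops H" "card T < CARD('d)" by (auto simp: T_def)
  have step: "z \<in> C" if "{y, z} \<in> edges H" "{y, z} \<noteq> e" "y \<in> C" for y z
  proof -
    have "(y, z) \<in> ?A" using that by (simp add: adjacency_def delete_edge_def)
    then show ?thesis using that(3) by (auto simp: C_def)
  qed
  have closed: "y \<in> C \<longleftrightarrow> z \<in> C" if "{y, z} \<in> edges H" "{y, z} \<noteq> e" for y z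
    using step[of y z] step[of z y] that by (auto simp: insert_commute)
  obtain a b where ab: "e = {a, b}" "a \<noteq> b" "a \<in> verts H" "b \<in> verts H"
    by (rule edge_doubleton[OF H e])
  \<comment> \<open>Otherwise \<open>C\<close> is closed under all edges of the connected
    \<open>H\<close>, and \<open>T\<close> contains all loops, of which there are more than
    \<open>d\<close>.\<close>
  have "\<not> (a \<in> C \<longleftrightarrow> b \<in> C)"
  proof
    assume "a \<in> C \<longleftrightarrow> b \<in> C"
    then have all: "y \<in> C \<longleftrightarrow> z \<in> C" if "{y, z} \<in> edges H" for y z
      using closed[OF that] ab(1) by (auto simp: doubleton_eq_iff)
    have "y \<in> C" if "(w, y) \<in> (adjacency H)\<^sup>*" for y
      using that
    proof induction
      case base
      show ?case by (simp add: C_def)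
    next
      case (step y z)
      then show ?case using all[of y z] by (simp add: adjacency_def)
    qed
    then have "T = loops H"
      using connected[OF w] H by (auto simp: T_def looped_simple_graph_def)
    then show False using T card_loops_gt[OF ab(3,4,2)] by simp
  qed
  then obtain u v where uv: "e = {u, v}" "u \<noteq> v" "u \<in> verts H" "v \<in> verts H" "u \<in> C" "v \<notin> C"
    using ab by (metis insert_commute)
  obtain x where x: "x \<bullet> (p u - p v) = 1" "\<And>l. l \<in> T \<Longrightarrow> x \<bullet> q l = 0"
    by (rule generic_edge_direction[OF gen T uv(3,4,2)]) blast
  have x0: "x \<noteq> 0" using x(1) by auto
  \<comment> \<open>The translation replaces \<open>p u - p v\<close> by its mirror image in the
    hyperplane orthogonal to \<open>x\<close>; the numerator is 2 because \<open>x\<close> has inner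
    product 1 with it.\<close>
  define s where "s = 2 / (x \<bullet> x)"
  have s: "norm (p u - p v - s *\<^sub>R x) = norm (p u - p v)"
    using norm_reflection[OF x0, of "p u - p v"] x(1) by (simp add: s_def)
  define p' where "p' y = (if y \<in> C then p y - s *\<^sub>R x else p y)" for y
  have "equivalent_frameworks H q p p'"
    unfolding equivalent_frameworks_def
  proof (intro conjI allI impI ballI)
    fix y z assume yz: "{y, z} \<in> edges H"
    show "norm (p y - p z) = norm (p' y - p' z)"
    proof (cases "{y, z} = e")
      case True
      then consider "y = u" "z = v" | "y = v" "z = u" using uv(1) by (auto simp: doubleton_eq_iff)
      then show ?thesis
      proof cases
        case 1
        then show ?thesis using s uv by (simp add: p'_def algebra_simps)
      next
        case 2
        then have "p' y - p' z = - (p u - p v - s *\<^sub>R x)" using uv by (simp add: p'_def)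
        then have "norm (p' y - p' z) = norm (p u - p v)" using s by (simp only: norm_minus_cancel)
        then show ?thesis using 2 by (simp add: norm_minus_commute)
      qed
    next
      case False
      then show ?thesis using closed[OF yz] by (simp add: p'_def)
    qed
  next
    fix l assume "l \<in> loops H"
    then show "p (anchor H l) \<bullet> q l = p' (anchor H l) \<bullet> q l"
      using x(2)[of l] by (simp add: p'_def T_def inner_diff_left)
  qed
  then have "p' u = p u" using rigid_contradiction uv(3) by blast
  then show False using uv(5) x0 by (simp add: p'_def s_def)
qed

text \<open>Common to edges and loops: \<open>d\<close> generic loop directions span, which bounds
  the level set of the remaining constraints.\<close>

lemma rigid_constraint_removal:
  fixes k :: "('v, 'l, 'd) constraint"
  assumes simple: "looped_simple_graph H'" and sub: "loops H' \<subseteq> loops H"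
    and k: "k \<in> constraints H" "constraints H' = constraints H - {k}"
    and grad: "\<And>j x. j \<noteq> k \<Longrightarrow> constraint_grad H' q j x = constraint_grad H q j x"
    and loops: "\<And>v. v \<in> verts H' \<Longrightarrow>
      CARD('d) \<le> card {l \<in> loops H'. (anchor H' l, v) \<in> (adjacency H')\<^sup>*}"
  shows "rigid TYPE('d) H'"
proof -
  have "span (q ` {l \<in> loops H'. (anchor H' l, v) \<in> (adjacency H')\<^sup>*}) = UNIV" if "v \<in> verts H'" for v
    using loops[OF that] sub by (intro generic_loops_span[OF gen]) auto
  then have "bounded {x. \<forall>j\<in>constraints H'. constraint_fun H' q j x = constraint_fun H q j (configuration p)}"
    by (intro constraints_bounded[OF simple])
  moreover have "{x. \<forall>j\<in>constraints H'. constraint_fun H' q j x = constraint_fun H q j (configuration p)} =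
      {x. \<forall>j\<in>constraints H - {k}. constraint_fun H q j x = constraint_fun H q j (configuration p)}"
    by (auto simp: k(2) constraint_fun_def grad)
  ultimately have "bounded {x. \<forall>j\<in>constraints H - {k}.
      constraint_fun H q j x = constraint_fun H q j (configuration p)}" by simp
  then obtain x where
    "dim ((\<lambda>j. constraint_grad H q j x) ` (constraints H - {k})) = DIM(real^('v \<times> 'd))"
    using constraint_removal_full_rank[OF H gen rig k(1)] by blast
  moreover have "(\<lambda>j. constraint_grad H' q j x) ` constraints H' =
      (\<lambda>j. constraint_grad H q j x) ` (constraints H - {k})"
    by (auto simp: k(2) grad intro!: image_cong)
  ultimately show ?thesis
    unfolding rigid_iff_dim_constraint_grad[OF simple] by (intro exI[of _ q] exI[of _ x]) simp
qed

lemma rigid_delete_edge: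
  assumes e: "e \<in> edges H"
  shows "rigid TYPE('d) (delete_edge H e)"
proof (rule rigid_constraint_removal[OF looped_simple_delete_edge[OF H] _ _ constraints_delete_edge
      constraint_grad_delete_edge])
  show "Inl (Inl e) \<in> constraints H" using e by (simp add: constraints_def)
  show "CARD('d) \<le> card {l \<in> loops (delete_edge H e).
      (anchor (delete_edge H e) l, v) \<in> (adjacency (delete_edge H e))\<^sup>*}"
    if "v \<in> verts (delete_edge H e)" for v
    using card_loops_edge_removal[OF e, of v] that by (simp add: delete_edge_def)
qed (auto simp: delete_edge_def)

lemma rigid_delete_loop:
  assumes l: "l \<in> loops H" and uv: "u \<in> verts H" "v \<in> verts H" "u \<noteq> v"
  shows "rigid TYPE('d) (delete_loop H l)"
proof (rule rigid_constraint_removal[OF looped_simple_delete_loop[OF H] _ _ constraints_delete_loop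
      constraint_grad_delete_loop])
  show "Inl (Inr l) \<in> constraints H" using l by (simp add: constraints_def)
  fix w assume w: "w \<in> verts (delete_loop H l)"
  \<comment> \<open>Adjacency ignores loops, so each vertex still reaches all remaining ones; more
    than \<open>d\<close> loops before means at least \<open>d\<close> now.\<close>
  have "{l' \<in> loops (delete_loop H l). (anchor (delete_loop H l) l', w) \<in> (adjacency (delete_loop H l))\<^sup>*} =
      loops H - {l}"
    using connected[of _ w] w H
    by (auto simp: delete_loop_def adjacency_def looped_simple_graph_def)
  then show "CARD('d) \<le> card {l' \<in> loops (delete_loop H l).
      (anchor (delete_loop H l) l', w) \<in> (adjacency (delete_loop H l))\<^sup>*}"
    using card_loops_gt[OF uv] l by simp
qed (auto simp: delete_loop_def)

text \<open>Edges leaving the component end in \<open>X\<close>, which the reflection fixes, so all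
  lengths survive. The component really moves, because \<open>d + 1\<close> generic points share no
  hyperplane.\<close>

lemma balanced_if_globally_rigid: "balanced CARD('d) H"
  unfolding balanced_def
proof (intro allI impI ballI notI)
  fix X C assume X: "X \<subseteq> verts H" "card X = CARD('d)"
    and C: "C \<in> graph_components (delete_verts H X)" and loopless: "loops C = {}"
  have "looped_simple_graph (delete_verts H X)"
    unfolding delete_verts_def by (rule looped_simple_induced_subgraph[OF H])
  from graph_component_cases[OF this C] obtain w where w: "w \<in> verts (delete_verts H X)" "w \<in> verts C"
    and sub: "verts C \<subseteq> verts (delete_verts H X)"
    and C_eq: "C = induced_subgraph (delete_verts H X) (verts C)"
    and closed: "\<And>u v. {u, v} \<in> edges (delete_verts H X) \<Longrightarrow> u \<in> verts C \<longleftrightarrow> v \<in> verts C"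
    by (metis (no_types, lifting) mem_Collect_eq rtrancl.rtrancl_refl subsetI)
  define W where "W = verts C"
  have W: "W \<subseteq> verts H" "W \<inter> X = {}" "w \<in> W"
    using sub w by (auto simp: W_def delete_verts_def induced_subgraph_def)
  have boundary: "v \<in> W \<or> v \<in> X" if "{u, v} \<in> edges H" "u \<in> W" for u v
  proof (rule ccontr)
    assume out: "\<not> (v \<in> W \<or> v \<in> X)"
    then have "{u, v} \<in> edges (delete_verts H X)"
      using that W H by (auto simp: delete_verts_def induced_subgraph_def looped_simple_graph_def)
    then show False using closed[of u v] that out by (auto simp: W_def)
  qed
  have "loops C = {l \<in> loops (delete_verts H X). anchor (delete_verts H X) l \<in> W}"
    unfolding W_def by (subst C_eq) (simp add: induced_subgraph_def)
  then have no_loop: "anchor H l \<notin> W" if "l \<in> loops H" for l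
    using that loopless W by (auto simp: delete_verts_def induced_subgraph_def)
  have "X \<noteq> {}" using X(2) by auto
  \<comment> \<open>With a point of \<open>X\<close> as origin only \<open>d - 1\<close> differences
    remain, which leaves a normal vector \<open>a\<close>.\<close>
  then obtain x0 where x0: "x0 \<in> X" by blast
  define Y where "Y = X - {x0}"
  have cardY: "card Y + 1 = CARD('d)" using x0 X(2) by (simp add: Y_def card_gt_0_iff Suc_leI)
  have "dim ((\<lambda>y. p y - p x0) ` Y) \<le> card Y"
    using dim_le_card'[of "(\<lambda>y. p y - p x0) ` Y"] card_image_le[of Y "\<lambda>y. p y - p x0"] by simp
  then have "dim ((\<lambda>y. p y - p x0) ` Y) < DIM(real^'d)" using cardY by simp
  then obtain a where a: "a \<noteq> 0" "\<And>z. z \<in> span ((\<lambda>y. p y - p x0) ` Y) \<Longrightarrow> orthogonal a z"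
    using orthogonal_to_subspace_exists by blast
  have aY: "a \<bullet> (p y - p x0) = 0" if "y \<in> X" for y
  proof (cases "y = x0")
    case False
    then have "p y - p x0 \<in> (\<lambda>y. p y - p x0) ` Y" using that by (auto simp: Y_def)
    then show ?thesis using a(2)[OF span_base] by (simp add: orthogonal_def)
  qed simp
  have aw: "a \<bullet> (p w - p x0) \<noteq> 0"
  proof
    assume "a \<bullet> (p w - p x0) = 0"
    then have orth: "orthogonal a z" if "z \<in> (\<lambda>y. p y - p x0) ` insert w Y" for z
      using that aY by (auto simp: orthogonal_def Y_def)
    have wY: "w \<notin> Y" "insert w Y \<subseteq> verts H" "x0 \<in> verts H" "x0 \<notin> insert w Y"
      using W X(1) x0 by (auto simp: Y_def)
    have card: "card (insert w Y) = CARD('d)" using wY(1) cardY by simp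
    then have "inj_on (\<lambda>y. p y - p x0) (insert w Y)" "independent ((\<lambda>y. p y - p x0) ` insert w Y)"
      using generic_affinely_independent[OF gen wY(2) _ wY(3,4)] by auto
    then have "UNIV \<subseteq> span ((\<lambda>y. p y - p x0) ` insert w Y)"
      using card_eq_dim[of "(\<lambda>y. p y - p x0) ` insert w Y" UNIV] card
      by (simp add: card_image del: image_insert)
    then have "orthogonal a a" using orthogonal_to_span[OF _ orth] by blast
    then show False using a(1) by (simp add: orthogonal_self)
  qed
  define r where "r y = y - (2 * (a \<bullet> (y - p x0)) / (a \<bullet> a)) *\<^sub>R a" for y
  have "r y - r z = (y - z) - (2 * (a \<bullet> (y - z)) / (a \<bullet> a)) *\<^sub>R a" for y z
    by (simp add: r_def inner_diff_right algebra_simps diff_divide_distrib)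
  then have isometry: "norm (r y - r z) = norm (y - z)" for y z
    using norm_reflection[OF a(1)] by simp
  have fixed: "r (p y) = p y" if "y \<in> X" for y using aY[OF that] by (simp add: r_def)
  define p' where "p' v = (if v \<in> W then r (p v) else p v)" for v
  have "equivalent_frameworks H q p p'"
    unfolding equivalent_frameworks_def
  proof (intro conjI allI impI ballI)
    fix u v assume uv: "{u, v} \<in> edges H"
    then have "{v, u} \<in> edges H" by (simp add: insert_commute)
    then show "norm (p u - p v) = norm (p' u - p' v)"
      using boundary[OF uv] boundary[of v u] fixed isometry[of "p u" "p v"] by (auto simp: p'_def)
  next
    fix l assume "l \<in> loops H"
    then show "p (anchor H l) \<bullet> q l = p' (anchor H l) \<bullet> q l" using no_loop by (simp add: p'_def)
  qed
  then have "p' w = p w" using rigid_contradiction W by blast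
  then show False using W(3) aw a(1) by (simp add: p'_def r_def)
qed

end

theorem theorem3p2:
  fixes G :: "('v::finite, 'l::finite) lgraph"
    and p :: "'v \<Rightarrow> real^'d::finite"
    and q :: "'l \<Rightarrow> real^'d"
  assumes "looped_simple_graph G"
    and "generic_framework G p q"
    and "globally_rigid G p q"
  shows "\<forall>H \<in> graph_components G.
    ((\<exists>v. verts H = {v}) \<and> CARD('d) \<le> card (loops H)) \<or>
    (balanced CARD('d) H \<and> redundantly_rigid TYPE('d) H)"
proof
  fix H assume C: "H \<in> graph_components G"
  obtain w where w: "w \<in> verts H" and H_eq: "H = induced_subgraph G (verts H)"
    by (rule graph_component_cases[OF assms(1) C]) auto
  have H: "looped_simple_graph H"
    by (subst H_eq) (rule looped_simple_induced_subgraph[OF assms(1)])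
  have "verts (induced_subgraph G W) \<subseteq> verts G" "loops (induced_subgraph G W) \<subseteq> loops G" for W
    by (auto simp: induced_subgraph_def)
  from this[of "verts H"] have "verts H \<subseteq> verts G" "loops H \<subseteq> loops G"
    using H_eq by simp_all
  then have gen: "generic_framework H p q" by (rule generic_framework_mono[OF assms(2)])
  have rig: "globally_rigid H p q" by (rule graph_component_globally_rigid[OF assms(1) C assms(3)])
  note conn = graph_component_connected[OF assms(1) C]
  show "((\<exists>v. verts H = {v}) \<and> CARD('d) \<le> card (loops H)) \<or>
    (balanced CARD('d) H \<and> redundantly_rigid TYPE('d) H)"
  proof (cases "verts H = {w}")
    case True
    then show ?thesis using single_vertex_loops[OF H gen rig conn True] by blast
  next
    case False
    \<comment> \<open>A second vertex guarantees more than \<open>d\<close> loops, so that any one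
      loop can be spared.\<close>
    then obtain u where u: "u \<in> verts H" "u \<noteq> w" using w by auto
    have "redundantly_rigid TYPE('d) H"
      unfolding redundantly_rigid_def
      using rigid_delete_edge[OF H gen rig conn] rigid_delete_loop[OF H gen rig conn _ u(1) w u(2)]
      by blast
    then show ?thesis using balanced_if_globally_rigid[OF H gen rig conn] by blast
  qed
qed

end
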